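(* Let $F : \mathbb{N} \rightarrow \mathbb{N}$ be a nondecreasing function for which there exists $C > 1$ such that for all $n \in \mathbb{N}$, $F(n)^n \leq F(Cn)$. Then there exist a residually finite group $G$, generated by a finite set $S$, and constants $C_1', C_2' > 0$ such that for all $n \in \mathbb{N}$, $$F(C_1' n) \leq \mathcal{F}_G^S(n) \leq \mathcal{R}_G^S(n) \leq F(C_2' n).$$
   Context: $\mathbb{N}=\{1,2,3,\dots\}$. For a function $F:\mathbb{N}\to\mathbb{N}$ and a real $x\in(0,\infty)$ that is not an integer, $F(x)$ means $F(\lceil x\rceil)$. A group $G$ is residually finite if for every nontrivial $g\in G$ there is a finite-index subgroup of $G$ not containing $g$. For $G$ generated by a finite set $S$, let $B_S(n)=\{s_1\cdots s_m : 0\le m\le n,\ s_i\in S\cup S^{-1}\}$. The normal depth of a nontrivial $g\in G$ is the minimal index of a finite-index normal subgroup of $G$ not containing $g$. The residual finiteness growth function $\mathcal{F}_G^S:\mathbb{N}\to\mathbb{N}$ is defined by letting $\mathcal{F}_G^S(n)$ be the maximal normal depth among the nontrivial elements of $B_S(n)$ (with value $1$ if there are none). The injectivity radius of a finite-index subgroup $H\le G$ is the maximal $n$ for which the coset map $g\mapsto gH$ is injective on $B_S(n)$ (or $+\infty$ if the set of such $n$ is unbounded). The full residual finiteness growth function $\mathcal{R}_G^S:\mathbb{N}\to\mathbb{N}$ is defined by letting $\mathcal{R}_G^S(n)$ be the minimal index of a finite-index normal subgroup of $G$ of injectivity radius at least $n$. *)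

theory Defs
  imports Complex_Main "HOL-Algebra.Coset" "HOL-Algebra.Generated_Groups"
    "HOL-Library.Extended_Nat"
begin

text \<open>
  Functions on the positive integers are rendered as functions \<open>nat \<Rightarrow> nat\<close> of which only the
  arguments \<open>n \<ge> 1\<close> are ever used.  \<open>at_real F x\<close>, for real \<open>x > 0\<close>, is \<open>F\<close> at the ceiling of \<open>x\<close>;
  this is \<open>F x\<close> itself when \<open>x\<close> is a positive integer.
\<close>

definition at_real :: "(nat \<Rightarrow> nat) \<Rightarrow> real \<Rightarrow> nat" where
  "at_real F x = F (nat \<lceil>x\<rceil>)"

definition finite_index :: "('a, 'b) monoid_scheme \<Rightarrow> 'a set \<Rightarrow> bool" where
  "finite_index G H \<longleftrightarrow> finite (rcosets\<^bsub>G\<^esub> H)"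

definition subgroup_index :: "('a, 'b) monoid_scheme \<Rightarrow> 'a set \<Rightarrow> nat" where
  "subgroup_index G H = card (rcosets\<^bsub>G\<^esub> H)"

definition residually_finite :: "('a, 'b) monoid_scheme \<Rightarrow> bool" where
  "residually_finite G \<longleftrightarrow>
     (\<forall>g \<in> carrier G - {\<one>\<^bsub>G\<^esub>}. \<exists>H. subgroup H G \<and> finite_index G H \<and> g \<notin> H)"

definition word_ball :: "('a, 'b) monoid_scheme \<Rightarrow> 'a set \<Rightarrow> nat \<Rightarrow> 'a set" where
  "word_ball G S n =
     {foldr (\<lambda>x y. x \<otimes>\<^bsub>G\<^esub> y) ws \<one>\<^bsub>G\<^esub> | ws. set ws \<subseteq> S \<union> m_inv G ` S \<and> length ws \<le> n}"

text \<open>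
  The minima below are over nonempty sets when \<open>G\<close> is a residually finite group, \<open>g\<close> is a
  nontrivial element of \<open>G\<close>, and \<open>S\<close> is finite.
\<close>

definition normal_depth :: "('a, 'b) monoid_scheme \<Rightarrow> 'a \<Rightarrow> nat" where
  "normal_depth G g =
     (LEAST k. \<exists>N. N \<lhd> G \<and> finite_index G N \<and> g \<notin> N \<and> subgroup_index G N = k)"

definition rf_growth :: "('a, 'b) monoid_scheme \<Rightarrow> 'a set \<Rightarrow> nat \<Rightarrow> nat" where
  "rf_growth G S n =
     (if word_ball G S n - {\<one>\<^bsub>G\<^esub>} = {} then 1
      else Max (normal_depth G ` (word_ball G S n - {\<one>\<^bsub>G\<^esub>})))"

text \<open>
  In \<open>enat\<close>, \<open>Sup\<close> of a finite nonempty set is its maximum and \<open>Sup\<close> of an infinite set is \<open>\<infinity>\<close>.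
  If the coset map is injective on no ball of radius \<open>n \<ge> 1\<close>, the radius is \<open>Sup {} = 0\<close>, so it
  is not at least \<open>n\<close> for any \<open>n \<ge> 1\<close>.
\<close>

definition injectivity_radius :: "('a, 'b) monoid_scheme \<Rightarrow> 'a set \<Rightarrow> 'a set \<Rightarrow> enat" where
  "injectivity_radius G S H =
     Sup {enat n | n. n \<ge> 1 \<and> inj_on (\<lambda>g. g <#\<^bsub>G\<^esub> H) (word_ball G S n)}"

definition full_rf_growth :: "('a, 'b) monoid_scheme \<Rightarrow> 'a set \<Rightarrow> nat \<Rightarrow> nat" where
  "full_rf_growth G S n =
     (LEAST k. \<exists>N. N \<lhd> G \<and> finite_index G N \<and> enat n \<le> injectivity_radius G S N
                  \<and> subgroup_index G N = k)"

end

theory Submission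
  imports Defs "HOL-Computational_Algebra.Primes" "HOL-Algebra.Multiplicative_Group"
    "HOL-Algebra.Weak_Morphisms" "HOL-Library.Countable_Set"
begin

text \<open>
  The group is a diagonal product, over \<open>k\<close>, of wreath products of a dihedral group of order \<open>2 * p k\<close>
  (\<open>p k\<close> an odd prime) with a cyclic group of order \<open>2 ^ (k + 1)\<close>.  It is generated by the simultaneous
  shift and by two involutions: in coordinate \<open>k\<close> they are reflections generating the dihedral group,
  the first one in the lamp at \<open>0\<close>, the second one in the lamp at \<open>2 ^ k\<close>.

  The two reflections meet in coordinate \<open>k\<close> only after conjugation by the \<open>2 ^ k\<close>-th power of the
  shift, and then in no other coordinate.  This gives an element of length \<open>O(2 ^ k)\<close> and order \<open>p k\<close>;
  any quotient in which it survives has an element of order \<open>p k\<close>, so its normal depth is at least \<open>p k\<close>.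
  Conversely, words of length less than \<open>2 ^ (K - 1)\<close> cannot make the two lamps interact in coordinate \<open>K\<close>
  or later, so coordinate \<open>K\<close> already decides whether they act trivially on all later ones.  Hence the
  kernel of the action on the coordinates up to \<open>K\<close> has injectivity radius of order \<open>2 ^ K\<close>.
  Its index is at most \<open>M\<close> to the power \<open>O(2 ^ K)\<close>, where \<open>M\<close> bounds \<open>2 ^ (k + 1) * p k\<close> for \<open>k \<le> K\<close>.

  Taking for \<open>p k\<close> a prime between \<open>F (c * 2 ^ k)\<close> and its cube, the hypothesis \<open>F n ^ n \<le> F (C * n)\<close>
  absorbs the exponent.
\<close>

section \<open>Primes between a number and its cube\<close>

text \<open>
  The recurrence of the Leibniz harmonic triangle: \<open>1 / (k * (n choose k))\<close> is an integer combination of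
  \<open>1 / 1, \<dots>, 1 / n\<close>.
\<close>

lemma mult_binomial_dvd_Lcm:
  fixes k n :: nat
  assumes "1 \<le> k" "k \<le> n"
  shows "k * (n choose k) dvd Lcm {1..n}"
  using assms
proof (induction k arbitrary: n rule: nat_induct_at_least)
  case base
  then show ?case by simp
next
  case (Suc k n)
  define L where "L = Lcm {1..n}"
  have k: "1 \<le> k" "k < n" using Suc by auto
  have 1: "k * (n choose k) dvd L"
    using Suc.IH[of n] k by (simp add: L_def)
  have "k * ((n - 1) choose k) dvd Lcm {1..n-1}"
    using Suc.IH[of "n-1"] k by simp
  also have "\<dots> dvd L" unfolding L_def by (rule Lcm_subset) auto
  finally have 2: "k * ((n - 1) choose k) dvd L" .
  obtain u v where u: "L = k * (n choose k) * u" and v: "L = k * ((n-1) choose k) * v"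
    using 1 2 by (metis dvdE)
  have id1: "Suc k * (n choose Suc k) = (n choose k) * (n - k)"
    by (metis binomial_absorb_comp binomial_absorption k(2) mult.commute)
  have id2: "n * ((n-1) choose k) = (n - k) * (n choose k)"
    using binomial_absorb_comp[of n k] by simp
  have "L * n = k * (n * ((n-1) choose k)) * v" by (subst v) simp
  also have "\<dots> = k * ((n - k) * (n choose k)) * v" by (simp only: id2)
  finally have "k * (n choose k) * (u * n) = k * (n choose k) * ((n - k) * v)"
    by (subst (asm) u) (simp only: ac_simps)
  moreover have "k * (n choose k) \<noteq> 0" using k by simp
  ultimately have "u * n = (n - k) * v" by (metis mult_left_cancel)
  \<comment> \<open>The cofactor sought for \<open>(n choose k) * (n - k)\<close> is
    \<open>v - u\<close>, the difference of the two known ones.\<close>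
  hence "int (n - k) * int v = int u * int n" by (metis of_nat_mult)
  hence "int (n - k) * (int v - int u) = int k * int u"
    using k by (simp add: of_nat_diff algebra_simps)
  moreover have "int L = int (n choose k) * (int k * int u)" by (subst u) simp
  ultimately have "int L = int ((n choose k) * (n - k)) * (int v - int u)" by simp
  hence "int ((n choose k) * (n - k)) dvd int L" by simp
  hence "(n choose k) * (n - k) dvd L" using of_nat_dvd_iff by blast
  then show ?case unfolding id1 L_def .
qed


section \<open>Upper bound for the least common multiple, and gaps between primes\<close>

text \<open>The multiplicity in an lcm is a maximum, attained at one of the numbers up to
  \<open>n\<close>; that number is a multiple of the power of \<open>p\<close>.\<close>

lemma prime_power_multiplicity_Lcm_le:
  fixes p n :: nat
  assumes "prime p" "n \<ge> 1"
  shows "p ^ multiplicity p (Lcm {1..n}) \<le> n"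
  using assms(2)
proof (induction n rule: nat_induct_at_least)
  case base
  then show ?case by simp
next
  case (Suc n)
  have eq: "Lcm {1..Suc n} = lcm (Suc n) (Lcm {1..n})"
    by (simp add: atLeastAtMostSuc_conv)
  have "Lcm {1..n} \<noteq> 0" by (simp add: Lcm_0_iff)
  hence "multiplicity p (Lcm {1..Suc n}) = max (multiplicity p (Suc n)) (multiplicity p (Lcm {1..n}))"
    unfolding eq by (intro multiplicity_lcm assms) auto
  moreover have "p ^ multiplicity p (Suc n) \<le> Suc n"
    by (intro dvd_imp_le multiplicity_dvd) auto
  ultimately show ?case using Suc by (auto simp: max_def)
qed

text \<open>At most \<open>x\<close> primes divide the lcm, and each contributes a prime power of
  size at most \<open>n\<close>.\<close>

lemma Lcm_le_power:
  fixes n x :: nat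
  assumes "n \<ge> 1" and "\<And>p. prime p \<Longrightarrow> p \<le> n \<Longrightarrow> p \<le> x"
  shows "Lcm {1..n} \<le> n ^ x"
proof -
  let ?L = "Lcm {1..n}"
  have L0: "?L \<noteq> 0" by (simp add: Lcm_0_iff)
  have sub: "prime_factors ?L \<subseteq> {1..x}"
  proof
    fix p assume p: "p \<in> prime_factors ?L"
    hence pp: "prime p" by auto
    have "multiplicity p ?L \<ge> 1" using p by (simp add: prime_factors_multiplicity Suc_leI)
    hence "p ^ 1 \<le> p ^ multiplicity p ?L"
      using prime_gt_0_nat[OF pp] by (intro power_increasing) auto
    also have "\<dots> \<le> n" by (rule prime_power_multiplicity_Lcm_le[OF pp assms(1)])
    finally show "p \<in> {1..x}" using assms(2)[OF pp] prime_gt_0_nat[OF pp] by auto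
  qed
  have "?L = (\<Prod>p\<in>prime_factors ?L. p ^ multiplicity p ?L)"
    using prod_prime_factors[OF L0] by simp
  also have "\<dots> \<le> (\<Prod>p\<in>prime_factors ?L. n)"
    by (intro prod_mono conjI prime_power_multiplicity_Lcm_le assms) auto
  also have "\<dots> = n ^ card (prime_factors ?L)" by simp
  also have "\<dots> \<le> n ^ x"
    using card_mono[OF _ sub] assms(1) by (intro power_increasing) auto
  finally show ?thesis .
qed

text \<open>For \<open>k = 4 ^ j\<close>, a gap without primes would squeeze
  \<open>Lcm {1..2*k}\<close> between \<open>2 ^ k\<close> and \<open>(2 * k) ^ (2 ^ j)\<close>.
  This gives \<open>2 ^ j \<le> 2 * j + 1\<close>, false from \<open>j = 3\<close> on.\<close>

lemma ex_prime_between_powers: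
  fixes j :: nat
  assumes "j \<ge> 3"
  shows "\<exists>p. prime p \<and> (2 :: nat) ^ j < p \<and> p \<le> 2 ^ (2 * j + 1)"
proof (rule ccontr)
  assume no: "\<not> ?thesis"
  define k :: nat where "k = 4 ^ j"
  have k1: "k \<ge> 1" by (simp add: k_def)
  have N: "2 * k = 2 ^ (2 * j + 1)" by (simp add: k_def power_mult)
  have "real (2 ^ k) \<le> real ((2 * k) choose k)"
    using binomial_ge_n_over_k_pow_k[of k "2*k", where ?'a = real] k1 by simp
  hence "2 ^ k \<le> (2 * k) choose k" by (simp only: of_nat_le_iff)
  also have "\<dots> \<le> k * ((2 * k) choose k)" using k1 by simp
  also have "\<dots> \<le> Lcm {1..2*k}"
    using k1 by (intro dvd_imp_le mult_binomial_dvd_Lcm) (auto intro!: Nat.gr0I simp: Lcm_0_iff)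
  also have "\<dots> \<le> (2 * k) ^ (2 ^ j)"
    using no k1 N by (intro Lcm_le_power) (auto simp: not_less)
  also have "\<dots> = 2 ^ ((2 * j + 1) * 2 ^ j)" unfolding N by (rule power_mult[symmetric])
  finally have "k \<le> (2 * j + 1) * 2 ^ j" by (simp only: power_increasing_iff)
  moreover have "2 * j + 1 < 2 ^ j" using assms
    by (induction j rule: nat_induct_at_least) auto
  hence "(2 * j + 1) * 2 ^ j < 2 ^ j * 2 ^ j" by (intro mult_strict_right_mono) auto
  moreover have "(2::nat) ^ j * 2 ^ j = k" by (simp add: k_def flip: power_mult_distrib)
  ultimately show False by linarith
qed

lemma ex_prime_le_cube:
  fixes x :: nat
  assumes "x \<ge> 8"
  shows "\<exists>p. prime p \<and> x \<le> p \<and> p \<le> x ^ 3"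
proof -
  obtain i where i: "2 ^ i \<le> x" "x < 2 ^ Suc i"
    using ex_power_ivl1[of 2 x] assms by auto
  have "i \<ge> 3"
  proof (rule ccontr)
    assume "\<not> i \<ge> 3"
    hence "(2::nat) ^ Suc i \<le> 2 ^ 3" by (intro power_increasing) auto
    with i assms show False by simp
  qed
  then obtain p :: nat where p: "prime p" "2 ^ Suc i < p" "p \<le> 2 ^ (2 * Suc i + 1)"
    using ex_prime_between_powers[of "Suc i"] by auto
  have "(2::nat) ^ (2 * Suc i + 1) = 8 * (2 ^ i) ^ 2" by (simp add: power_mult flip: power_mult_distrib power2_eq_square) (simp add: power_mult[symmetric] mult.commute power2_eq_square flip: power_mult_distrib)
  also have "\<dots> \<le> x * x ^ 2" using assms i by (intro mult_mono power_mono) auto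
  finally show ?thesis using p i by (intro exI[of _ p]) (auto simp: power3_eq_cube power2_eq_square)
qed

section \<open>Word balls and residual finiteness growth\<close>

lemma word_ball_mono: "m \<le> n \<Longrightarrow> word_ball G S m \<subseteq> word_ball G S n"
  unfolding word_ball_def using le_trans by blast

lemma one_in_word_ball: "\<one>\<^bsub>G\<^esub> \<in> word_ball G S n"
  unfolding word_ball_def by (auto intro!: exI[of _ "[]"])

lemma generators_subset_word_ball:
  fixes G (structure)
  assumes "group G" "S \<subseteq> carrier G" "n \<ge> 1"
  shows "S \<subseteq> word_ball G S n"
proof
  interpret group G by fact
  fix x assume "x \<in> S"
  thus "x \<in> word_ball G S n"
    unfolding word_ball_def using assms by (auto intro!: exI[of _ "[x]"])
qed

lemma finite_word_ball:
  assumes "finite S"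
  shows "finite (word_ball G S n)"
proof -
  have "word_ball G S n = (\<lambda>ws. foldr (\<lambda>x y. x \<otimes>\<^bsub>G\<^esub> y) ws \<one>\<^bsub>G\<^esub>) `
          {ws. set ws \<subseteq> S \<union> m_inv G ` S \<and> length ws \<le> n}"
    unfolding word_ball_def by auto
  thus ?thesis using assms by (simp add: finite_lists_length_le)
qed

lemma word_ball_subset_carrier:
  fixes G (structure)
  assumes "group G" "S \<subseteq> carrier G"
  shows "word_ball G S n \<subseteq> carrier G"
proof -
  interpret group G by fact
  have "foldr (\<lambda>x y. x \<otimes> y) ws \<one> \<in> carrier G" if "set ws \<subseteq> S \<union> m_inv G ` S" for ws
    using that assms(2) by (induction ws) auto
  thus ?thesis unfolding word_ball_def by auto
qed

text \<open>Balls are nested, so injectivity at one radius gives it at all smaller ones. This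
  removes the supremum from all later arguments.\<close>

lemma le_injectivity_radius_iff:
  assumes "n \<ge> 1"
  shows "enat n \<le> injectivity_radius G S H \<longleftrightarrow> inj_on (\<lambda>g. g <#\<^bsub>G\<^esub> H) (word_ball G S n)"
proof
  let ?A = "{enat n | n. n \<ge> 1 \<and> inj_on (\<lambda>g. g <#\<^bsub>G\<^esub> H) (word_ball G S n)}"
  assume "enat n \<le> injectivity_radius G S H"
  then have "\<not> Sup ?A < enat n" by (simp add: injectivity_radius_def)
  moreover have "Sup ?A < enat n" if "\<forall>x\<in>?A. x < enat n"
  proof -
    obtain m where m: "n = Suc m" using assms by (cases n) auto
    have "x \<le> enat m" if "x \<in> ?A" for x
    proof -
      have "x < enat (Suc m)" using \<open>\<forall>x\<in>?A. x < enat n\<close> that m by auto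
      thus ?thesis by (cases x) auto
    qed
    hence "Sup ?A \<le> enat m" by (rule Sup_least)
    thus ?thesis using m by (meson enat_ord_simps(2) le_less_trans lessI)
  qed
  ultimately obtain x where "x \<in> ?A" "\<not> x < enat n" by blast
  then obtain k where "k \<ge> n" "inj_on (\<lambda>g. g <#\<^bsub>G\<^esub> H) (word_ball G S k)"
    by (auto simp: not_less)
  thus "inj_on (\<lambda>g. g <#\<^bsub>G\<^esub> H) (word_ball G S n)"
    using word_ball_mono by (meson inj_on_subset)
next
  assume "inj_on (\<lambda>g. g <#\<^bsub>G\<^esub> H) (word_ball G S n)"
  thus "enat n \<le> injectivity_radius G S H"
    unfolding injectivity_radius_def using assms by (intro Sup_upper) auto
qed

lemma subgroup_index_pos:
  fixes G (structure)
  assumes "group G" "finite_index G N"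
  shows "subgroup_index G N \<ge> 1"
proof -
  interpret group G by fact
  have "rcosets N \<noteq> {}" unfolding RCOSETS_def using one_closed by blast
  thus ?thesis using assms(2) unfolding subgroup_index_def finite_index_def
    by (simp add: Suc_leI card_gt_0_iff)
qed

lemma normal_depth_le:
  assumes "N \<lhd> G" "finite_index G N" "g \<notin> N"
  shows "normal_depth G g \<le> subgroup_index G N"
  unfolding normal_depth_def using assms by (intro Least_le) blast

lemma full_rf_growth_le:
  assumes "N \<lhd> G" "finite_index G N" "enat n \<le> injectivity_radius G S N"
  shows "full_rf_growth G S n \<le> subgroup_index G N"
  unfolding full_rf_growth_def using assms by (intro Least_le) blast

text \<open>A normal subgroup that realises the full growth separates \<open>\<one>\<close> from
  every other element of the ball, so it bounds their depths. The given \<open>N\<close> ensures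
  that the minimum is attained.\<close>

lemma rf_growth_le_full_rf_growth:
  fixes G (structure)
  assumes "group G" "finite S" "S \<subseteq> carrier G" "n \<ge> 1"
    and "N \<lhd> G" "finite_index G N" "enat n \<le> injectivity_radius G S N"
  shows "rf_growth G S n \<le> full_rf_growth G S n"
proof -
  interpret group G by fact
  let ?P = "\<lambda>k. \<exists>N. N \<lhd> G \<and> finite_index G N \<and> enat n \<le> injectivity_radius G S N
    \<and> subgroup_index G N = k"
  have "\<exists>k. ?P k" using assms(5-7) by blast
  hence "?P (full_rf_growth G S n)"
    unfolding full_rf_growth_def by (rule LeastI_ex[where P = ?P])
  then obtain M where M: "M \<lhd> G" "finite_index G M" "enat n \<le> injectivity_radius G S M"
    and eq: "subgroup_index G M = full_rf_growth G S n" by blast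
  interpret M: normal M G by fact
  have inj: "inj_on (\<lambda>g. g <# M) (word_ball G S n)"
    using M(3) le_injectivity_radius_iff[OF assms(4)] by blast
  have "normal_depth G g \<le> full_rf_growth G S n" if g: "g \<in> word_ball G S n - {\<one>}" for g
  proof -
    have gc: "g \<in> carrier G" using g word_ball_subset_carrier[OF assms(1,3)] by blast
    have "g \<notin> M"
    proof
      assume "g \<in> M"
      hence "g <# M = \<one> <# M"
        using M.coset_eq gc coset_join2[OF gc M.subgroup_axioms] lcos_mult_one[OF M.subset] by simp
      with inj have "g = \<one>" using g one_in_word_ball[of G S n] by (auto dest: inj_onD)
      with g show False by simp
    qed
    thus ?thesis using normal_depth_le[OF M(1,2)] eq by simp
  qed
  moreover have "finite (word_ball G S n)" by (rule finite_word_ball) fact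
  ultimately show ?thesis
    unfolding rf_growth_def using subgroup_index_pos[OF assms(1) M(2)] eq
    by (simp add: Max_le_iff)
qed

lemma normal_depth_le_rf_growth:
  assumes "finite S" "g \<in> word_ball G S n" "g \<noteq> \<one>\<^bsub>G\<^esub>"
  shows "normal_depth G g \<le> rf_growth G S n"
  using assms finite_word_ball[OF assms(1), of G n] unfolding rf_growth_def by auto

text \<open>The image of such an element in any quotient detecting it still has order \<open>p\<close>.\<close>

lemma prime_le_normal_depth:
  fixes G (structure) and p :: nat
  assumes "group G" "prime p" "g \<in> carrier G" "g [^]\<^bsub>G\<^esub> p = \<one>\<^bsub>G\<^esub>"
    and "N \<lhd> G" "finite_index G N" "g \<notin> N"
  shows "p \<le> normal_depth G g"
proof -
  interpret group G by fact
  let ?P = "\<lambda>k. \<exists>N. N \<lhd> G \<and> finite_index G N \<and> g \<notin> N \<and> subgroup_index G N = k"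
  have "\<exists>k. ?P k" using assms(5-7) by blast
  hence "?P (normal_depth G g)"
    unfolding normal_depth_def by (rule LeastI_ex[where P = ?P])
  then obtain M where M: "M \<lhd> G" "finite_index G M" "g \<notin> M" 
    and eq: "subgroup_index G M = normal_depth G g" by blast
  interpret M: normal M G by fact
  interpret Q: group "G Mod M" by (rule M.factorgroup_is_group)
  let ?x = "M #> g"
  have hom: "(\<lambda>a. M #> a) \<in> hom G (G Mod M)" by (rule M.r_coset_hom_Mod)
  have x: "?x \<in> carrier (G Mod M)" using hom assms(3) by (auto simp: hom_def)
  have "?x [^]\<^bsub>G Mod M\<^esub> p = M #> (g [^] p)"
    using group_hom.hom_nat_pow[of G "G Mod M" "\<lambda>a. M #> a" g p] hom assms(3)
    by (simp add: group_hom_def group_hom_axioms_def Q.is_group)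
  also have "\<dots> = \<one>\<^bsub>G Mod M\<^esub>" using assms(4) M.subset by (simp add: FactGroup_def)
  finally have "Q.ord ?x dvd p" using Q.pow_eq_id[OF x] by simp
  moreover have "Q.ord ?x \<noteq> 1"
  proof
    assume "Q.ord ?x = 1"
    hence "?x = M" using Q.ord_eq_1[OF x] by (simp add: FactGroup_def)
    thus False using M(3) rcos_self[OF assms(3) M.subgroup_axioms] by simp
  qed
  ultimately have "Q.ord ?x = p" using assms(2) by (auto simp: prime_nat_iff)
  hence "p dvd order (G Mod M)" using Q.ord_dvd_group_order[OF x] by simp
  moreover have "order (G Mod M) = normal_depth G g"
    using eq by (simp add: order_def FactGroup_def subgroup_index_def)
  moreover have "normal_depth G g \<ge> 1" using subgroup_index_pos[OF assms(1) M(2)] eq by simp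
  ultimately show ?thesis by (auto intro: dvd_imp_le)
qed

text \<open>Two elements of the ball of radius \<open>n\<close> in one coset differ by an element of
  \<open>N\<close> of length at most \<open>2 * n\<close>.\<close>

lemma le_injectivity_radiusI:
  fixes G (structure)
  assumes "group G" "S \<subseteq> carrier G" "N \<lhd> G" "n \<ge> 1"
    and "\<And>g. g \<in> word_ball G S (2 * n) \<Longrightarrow> g \<in> N \<Longrightarrow> g = \<one>\<^bsub>G\<^esub>"
  shows "enat n \<le> injectivity_radius G S N"
proof -
  interpret group G by fact
  interpret N: normal N G by fact
  have inv: "inv x \<in> S \<union> m_inv G ` S" if "x \<in> S \<union> m_inv G ` S" for x
    using that assms(2) by auto
  have inv_set: "set (rev (map (m_inv G) ws)) \<subseteq> S \<union> m_inv G ` S"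
    if "set ws \<subseteq> S \<union> m_inv G ` S" for ws
  proof
    fix x assume "x \<in> set (rev (map (m_inv G) ws))"
    then obtain y where "y \<in> set ws" "x = inv y" by auto
    thus "x \<in> S \<union> m_inv G ` S" using that inv by blast
  qed
  have foldr_in: "foldr (\<lambda>x y. x \<otimes> y) ws \<one> \<in> carrier G" if "set ws \<subseteq> S \<union> m_inv G ` S" for ws
    using that assms(2) by (induction ws) auto
  have foldr_append: "foldr (\<lambda>x y. x \<otimes> y) (vs @ ws) \<one> = 
      foldr (\<lambda>x y. x \<otimes> y) vs \<one> \<otimes> foldr (\<lambda>x y. x \<otimes> y) ws \<one>"
    if "set vs \<subseteq> S \<union> m_inv G ` S" "set ws \<subseteq> S \<union> m_inv G ` S" for vs ws
    using that(1)
  proof (induction vs)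
    case (Cons v vs)
    have "v \<in> carrier G" using Cons.prems assms(2) by auto
    with Cons show ?case using foldr_in[of vs] foldr_in[of ws] that(2)
      by (simp add: m_assoc)
  qed (use foldr_in[of ws] that in simp)
  have inv_foldr: "inv (foldr (\<lambda>x y. x \<otimes> y) ws \<one>) = foldr (\<lambda>x y. x \<otimes> y) (rev (map (m_inv G) ws)) \<one>"
    if "set ws \<subseteq> S \<union> m_inv G ` S" for ws
    using that
  proof (induction ws)
    case (Cons w ws)
    have w: "w \<in> carrier G" using Cons.prems assms(2) by auto
    have "set (rev (map (m_inv G) ws)) \<subseteq> S \<union> m_inv G ` S"
      using Cons.prems by (intro inv_set) auto
    moreover have "set [inv w] \<subseteq> S \<union> m_inv G ` S" using Cons.prems inv by auto
    ultimately have "foldr (\<lambda>x y. x \<otimes> y) (rev (map (m_inv G) (w # ws))) \<one> 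
       = foldr (\<lambda>x y. x \<otimes> y) (rev (map (m_inv G) ws)) \<one> \<otimes> inv w"
      using foldr_append[of "rev (map (m_inv G) ws)" "[inv w]"] w by simp
    with Cons show ?case using foldr_in[of ws] w by (simp add: inv_mult_group)
  qed simp
  have "inj_on (\<lambda>g. g <# N) (word_ball G S n)"
  proof (rule inj_onI)
    fix g h assume g: "g \<in> word_ball G S n" and h: "h \<in> word_ball G S n" and eq: "g <# N = h <# N"
    obtain vs where vs: "g = foldr (\<lambda>x y. x \<otimes> y) vs \<one>" "set vs \<subseteq> S \<union> m_inv G ` S" "length vs \<le> n"
      using g unfolding word_ball_def by blast
    obtain ws where ws: "h = foldr (\<lambda>x y. x \<otimes> y) ws \<one>" "set ws \<subseteq> S \<union> m_inv G ` S" "length ws \<le> n"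
      using h unfolding word_ball_def by blast
    have gc: "g \<in> carrier G" and hc: "h \<in> carrier G"
      using foldr_in vs ws by auto
    have "inv g \<otimes> h = foldr (\<lambda>x y. x \<otimes> y) (rev (map (m_inv G) vs) @ ws) \<one>"
      using inv_foldr[OF vs(2)] foldr_append[OF inv_set[OF vs(2)] ws(2)] vs(1) ws(1) by simp
    hence 1: "inv g \<otimes> h \<in> word_ball G S (2 * n)"
      unfolding word_ball_def using vs(3) ws(2,3) inv_set[OF vs(2)]
      by (intro CollectI exI[of _ "rev (map (m_inv G) vs) @ ws"] conjI) auto
    have "h \<otimes> \<one> \<in> h <# N" unfolding l_coset_def using N.one_closed by blast
    hence "h \<in> g <# N" using eq hc by simp
    then obtain k where k: "k \<in> N" "h = g \<otimes> k" unfolding l_coset_def by blast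
    have "inv g \<otimes> h = k"
      unfolding k(2) using gc N.mem_carrier[OF k(1)] by (simp flip: m_assoc)
    with 1 k(1) assms(5) have "k = \<one>" by blast
    thus "g = h" using k(2) gc by simp
  qed
  thus ?thesis using le_injectivity_radius_iff[OF assms(4)] by blast
qed

section \<open>Groups with countable carrier, and index bounds\<close>

text \<open>Numbering the elements transports the group structure to natural numbers, the carrier
  type of the final theorem.\<close>

lemma ex_iso_nat_group:
  assumes "group P" "countable (carrier P)"
  shows "\<exists>(G :: nat monoid) \<phi>. group G \<and> \<phi> \<in> iso G P"
proof -
  let ?f = "to_nat_on (carrier P)"
  have inj: "inj_on ?f (carrier P)" by (rule inj_on_to_nat_on) fact
  have G: "group (image_group ?f P)"
    by (rule group.inj_imp_image_group_is_group[OF assms(1) inj])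
  have "?f \<in> iso P (image_group ?f P)" by (rule inj_imp_image_group_iso[OF inj])
  hence "inv_into (carrier P) ?f \<in> iso (image_group ?f P) P"
    by (rule group.iso_set_sym[OF assms(1)])
  with G show ?thesis by blast
qed

text \<open>A value of \<open>f\<close> determines the coset, so there are no more cosets than
  values; \<open>f\<close> may be any map, not just a homomorphism.\<close>

lemma subgroup_index_le_card:
  fixes G (structure)
  assumes "group G" "subgroup H G" "finite B" "f \<in> carrier G \<rightarrow> B"
    and "\<And>x y. x \<in> carrier G \<Longrightarrow> y \<in> carrier G \<Longrightarrow> f x = f y \<Longrightarrow> x \<otimes> inv y \<in> H"
  shows "finite_index G H" "subgroup_index G H \<le> card B"
proof -
  interpret group G by fact
  interpret H: subgroup H G by fact
  have "rcosets H \<subseteq> (\<lambda>b. H #> inv_into (carrier G) f b) ` B"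
  proof
    fix C assume "C \<in> rcosets H"
    then obtain x where x: "x \<in> carrier G" "C = H #> x" unfolding RCOSETS_def by blast
    let ?y = "inv_into (carrier G) f (f x)"
    have y: "?y \<in> carrier G" "f ?y = f x" using x by (auto intro: inv_into_into f_inv_into_f)
    hence "?y \<otimes> inv x \<in> H" using assms(5) x by blast
    hence "?y \<in> H #> x" using x y H.rcos_module[OF is_group] by blast
    hence "C = H #> ?y" using x y repr_independence[OF _ _ assms(2)] by blast
    thus "C \<in> (\<lambda>b. H #> inv_into (carrier G) f b) ` B" using x assms(4) by blast
  qed
  thus "finite_index G H" "subgroup_index G H \<le> card B"
    unfolding finite_index_def subgroup_index_def using assms(3)
    by (auto intro: finite_subset surj_card_le)
qed

section \<open>The lamp group\<close>

datatype letter = Flip0 | Flip1 | Up | Down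

instance letter :: countable by countable_datatype

fun inv_letter :: "letter \<Rightarrow> letter" where
  "inv_letter Flip0 = Flip0"
| "inv_letter Flip1 = Flip1"
| "inv_letter Up = Down"
| "inv_letter Down = Up"

text \<open>The number of lamps in coordinate \<open>k\<close>, twice the distance
  \<open>2 ^ k\<close> between the two special ones.\<close>

definition per :: "nat \<Rightarrow> int" where
  "per k = 2 ^ (k + 1)"

lemma per_pos [simp]: "per k > 0"
  by (simp add: per_def)

text \<open>For \<open>j < k\<close> the modulus divides \<open>2 ^ k\<close> but not
  \<open>2 ^ j\<close>; for \<open>k < j\<close> the difference is nonzero and too small. Hence a
  shift by \<open>2 ^ k\<close> aligns the two special lamps in coordinate \<open>k\<close>
  alone.\<close>

lemma per_dvd_diff_iff: "per j dvd 2 ^ k - 2 ^ j \<longleftrightarrow> j = k"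
proof
  assume dvd: "per j dvd 2 ^ k - 2 ^ j"
  show "j = k"
  proof (rule linorder_cases[of j k])
    assume "j < k"
    hence "per j dvd 2 ^ k" unfolding per_def by (intro le_imp_power_dvd) simp
    with dvd have "per j dvd 2 ^ k - (2 ^ k - 2 ^ j)" by (rule dvd_diff[rotated])
    hence "(2::int) ^ (j + 1) dvd 2 ^ j" by (simp add: per_def)
    hence "(2::int) ^ (j + 1) \<le> 2 ^ j" by (rule zdvd_imp_le) simp
    thus ?thesis by simp
  next
    assume "k < j"
    hence "(2::int) ^ k < 2 ^ j" by simp
    moreover from dvd have "per j dvd 2 ^ j - 2 ^ k" by (subst dvd_diff_commute)
    ultimately have "per j \<le> 2 ^ j - 2 ^ k" by (intro zdvd_imp_le) auto
    moreover have "(2::int) ^ j > 0" "(2::int) ^ k > 0" by simp_all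
    ultimately show ?thesis unfolding per_def by simp
  qed
qed (simp add: per_def)

locale lamps =
  fixes p :: "nat \<Rightarrow> nat"
  assumes prime_p: "prime (p k)" and p_gt_2: "p k > 2"
begin

text \<open>
  The action on the points \<open>(k, i, x)\<close> with \<open>i\<close> taken modulo \<open>per k\<close> and \<open>x\<close> modulo \<open>p k\<close>.  Group elements
  are functions that factor through \<open>rep\<close>, so \<open>rep\<close>, not \<open>id\<close>, is the identity element.
\<close>

fun rep :: "nat \<times> int \<times> int \<Rightarrow> nat \<times> int \<times> int" where
  "rep (k, i, x) = (k, i mod per k, x mod p k)"

fun step :: "letter \<Rightarrow> nat \<times> int \<times> int \<Rightarrow> nat \<times> int \<times> int" where
  "step Flip0 (k, i, x) = (k, i mod per k, (if per k dvd i then - x else x) mod p k)"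
| "step Flip1 (k, i, x) = (k, i mod per k, (if per k dvd i - 2 ^ k then 1 - x else x) mod p k)"
| "step Up (k, i, x) = (k, (i + 1) mod per k, x mod p k)"
| "step Down (k, i, x) = (k, (i - 1) mod per k, x mod p k)"

fun act :: "letter list \<Rightarrow> nat \<times> int \<times> int \<Rightarrow> nat \<times> int \<times> int" where
  "act [] = rep"
| "act (l # w) = step l \<circ> act w"

declare act.simps(2) [simp del]

lemma act_Cons [simp]: "act (l # w) z = step l (act w z)"
  by (simp add: act.simps(2))

lemma rep_rep [simp]: "rep (rep z) = rep z"
  by (cases z) auto

lemma fst_rep [simp]: "fst (rep z) = fst z"
  by (cases z) auto

lemma rep_step [simp]: "rep (step l z) = step l z"
  by (cases "(l, z)" rule: step.cases) auto

lemma step_rep [simp]: "step l (rep z) = step l z"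
proof -
  have "per k dvd i mod per k - 2 ^ k \<longleftrightarrow> per k dvd i - 2 ^ k" for k i
    by (metis dvd_eq_mod_eq_0 mod_diff_left_eq)
  thus ?thesis
    by (cases "(l, z)" rule: step.cases)
       (auto simp: mod_minus_eq mod_simps dvd_mod_iff)
qed

lemma fst_step [simp]: "fst (step l z) = fst z"
  by (cases "(l, z)" rule: step.cases) auto

lemma step_inv_step: "step (inv_letter l) (step l z) = rep z"
proof -
  have "per k dvd i mod per k - 2 ^ k \<longleftrightarrow> per k dvd i - 2 ^ k" for k i
    by (metis dvd_eq_mod_eq_0 mod_diff_left_eq)
  thus ?thesis
    by (cases "(l, z)" rule: step.cases)
       (auto simp: mod_minus_eq mod_simps dvd_mod_iff)
qed

lemma rep_act [simp]: "rep (act w z) = act w z"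
  by (cases w) auto

lemma act_rep [simp]: "act w (rep z) = act w z"
  by (induction w) auto

lemma fst_act [simp]: "fst (act w z) = fst z"
  by (induction w) auto

lemma act_append [simp]: "act (v @ w) z = act v (act w z)"
  by (induction v) auto

lemma act_inv: "act (rev (map inv_letter w)) (act w z) = rep z"
proof (induction w arbitrary: z)
  case (Cons l w)
  have "act (rev (map inv_letter w)) (step (inv_letter l) (step l (act w z))) = rep z"
    unfolding step_inv_step using Cons by simp
  thus ?case by simp
qed simp

text \<open>The letters are closed under inversion, so the maps given by words already form a group.
  It is countable because there are countably many words.\<close>

definition lamp_group :: "(nat \<times> int \<times> int \<Rightarrow> nat \<times> int \<times> int) monoid" where
  "lamp_group = \<lparr>carrier = range act, monoid.mult = (\<circ>), one = rep\<rparr>"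

lemma group_lamp_group: "group lamp_group"
proof (rule groupI, goal_cases)
  case (1 x y)
  then obtain v w where vw: "x = act v" "y = act w" by (auto simp: lamp_group_def)
  have "x \<circ> y = act (v @ w)" unfolding vw by (auto simp: fun_eq_iff simp del: split_paired_All)
  thus ?case by (simp add: lamp_group_def)
next
  case 2
  show ?case using range_eqI[of rep act "[]"] by (simp add: lamp_group_def)
next
  case (3 x y z)
  show ?case by (simp add: lamp_group_def comp_assoc)
next
  case (4 x)
  then show ?case by (auto simp: lamp_group_def fun_eq_iff simp del: split_paired_All)
next
  case (5 x)
  then obtain w where w: "x = act w" by (auto simp: lamp_group_def)
  have "act (rev (map inv_letter w)) \<circ> x = rep"
    unfolding w by (auto simp: fun_eq_iff act_inv simp del: split_paired_All)
  thus ?case by (auto simp: lamp_group_def intro!: bexI[of _ "act (rev (map inv_letter w))"])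
qed

text \<open>For a fixed starting lamp the walk is the same for every \<open>x\<close>, and each
  letter is affine in \<open>x\<close>.\<close>

lemma act_affine: "\<exists>j c d. \<forall>x. act w (k, i, x) = (k, j mod per k, (c * x + d) mod p k)"
proof (induction w)
  case Nil
  show ?case by (intro exI[of _ i] exI[of _ 1] exI[of _ 0]) auto
next
  case (Cons l w)
  then obtain j c d where w: "\<And>x. act w (k, i, x) = (k, j mod per k, (c * x + d) mod p k)"
    by blast
  have w': "act w (k, i, x) = rep (k, j, c * x + d)" for x using w by simp
  show ?case
  proof (cases l)
    case Flip0
    show ?thesis unfolding Flip0 act_Cons w' step_rep
      by (rule exI[of _ j], rule exI[of _ "if per k dvd j then -c else c"],
          rule exI[of _ "if per k dvd j then -d else d"]) (auto simp: algebra_simps)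
  next
    case Flip1
    show ?thesis unfolding Flip1 act_Cons w' step_rep
      by (rule exI[of _ j], rule exI[of _ "if per k dvd j - 2 ^ k then -c else c"],
          rule exI[of _ "if per k dvd j - 2 ^ k then 1 - d else d"]) (auto simp: algebra_simps)
  next
    case Up
    show ?thesis unfolding Up act_Cons w' step_rep
      by (intro exI[of _ "j + 1"] exI[of _ c] exI[of _ d]) auto
  next
    case Down
    show ?thesis unfolding Down act_Cons w' step_rep
      by (intro exI[of _ "j - 1"] exI[of _ c] exI[of _ d]) auto
  qed
qed

text \<open>An affine map takes at \<open>x\<close> the value \<open>x\<close> times its value at 1
  plus \<open>1 - x\<close> times its value at 0.\<close>

lemma act_eqI:
  assumes "act v (k, i, 0) = act w (k, i, 0)" "act v (k, i, 1) = act w (k, i, 1)"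
  shows "act v (k, i, x) = act w (k, i, x)"
proof -
  obtain j c d where v: "\<And>x. act v (k, i, x) = (k, j mod per k, (c * x + d) mod p k)"
    using act_affine by blast
  obtain j' c' d' where w: "\<And>x. act w (k, i, x) = (k, j' mod per k, (c' * x + d') mod p k)"
    using act_affine by blast
  have "int (p k) dvd d - d'" "int (p k) dvd (c + d) - (c' + d')"
    using assms by (simp_all add: v w mod_eq_dvd_iff)
  hence "int (p k) dvd x * ((c + d) - (c' + d')) + (1 - x) * (d - d')" by simp
  also have "\<dots> = (c * x + d) - (c' * x + d')" by (simp add: algebra_simps)
  finally have "(c * x + d) mod p k = (c' * x + d') mod p k" by (simp add: mod_eq_dvd_iff)
  thus ?thesis using assms by (simp add: v w)
qed

end

section \<open>Short words\<close>

text \<open>Offsets of size at most \<open>n\<close> differ by less than the period.\<close>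

lemma near_unique:
  assumes "\<bar>u\<bar> \<le> int n" "\<bar>v\<bar> \<le> int n" "2 * n < 2 ^ k" "per k dvd i - u" "per k dvd i - v"
  shows "u = v"
proof (rule ccontr)
  assume "u \<noteq> v"
  have "per k dvd (i - u) - (i - v)" using assms(4,5) by (rule dvd_diff)
  hence "per k dvd \<bar>v - u\<bar>" by simp
  hence "per k \<le> \<bar>v - u\<bar>" using \<open>u \<noteq> v\<close> by (intro zdvd_imp_le) auto
  moreover have "int (2 * n) < int (2 ^ k)" using assms(3) by (simp only: of_nat_less_iff)
  ultimately show False using assms(1,2) by (simp add: per_def)
qed

text \<open>The windows of radius \<open>n\<close> around the two special lamps are disjoint:
  \<open>v - u + 2 ^ k\<close> lies strictly between 0 and \<open>per k\<close>.\<close>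

lemma near_far:
  assumes "\<bar>u\<bar> \<le> int n" "\<bar>v\<bar> \<le> int n" "2 * n < 2 ^ k" "per k dvd i - u"
  shows "\<not> per k dvd i - v - 2 ^ k"
proof
  assume "per k dvd i - v - 2 ^ k"
  with assms(4) have "per k dvd (i - u) - (i - v - 2 ^ k)" by (rule dvd_diff)
  hence dvd: "per k dvd v - u + 2 ^ k" by (simp add: algebra_simps)
  have "int (2 * n) < int (2 ^ k)" using assms(3) by (simp only: of_nat_less_iff)
  hence "0 < v - u + 2 ^ k" "v - u + 2 ^ k < per k" using assms(1,2) by (auto simp: per_def)
  with dvd show False using zdvd_imp_le by fastforce
qed

context lamps
begin

text \<open>
  On a coordinate whose two lamps are far apart, a short word flips each lamp position by at most one
  of the two reflections, so only parities matter: \<open>A\<close> and \<open>B\<close> are the positions (relative to the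
  two lamps) that are flipped an odd number of times.  They do not depend on the coordinate.
\<close>

lemma act_structure:
  "\<exists>c A B. \<bar>c\<bar> \<le> int (length w) \<and> A \<subseteq> {u. \<bar>u\<bar> \<le> int (length w)} \<and> B \<subseteq> {u. \<bar>u\<bar> \<le> int (length w)} \<and>
     (\<forall>k i x. 2 * length w < 2 ^ k \<longrightarrow>
        act w (k, i, x) = (k, (i + c) mod per k,
          (if \<exists>u\<in>A. per k dvd i - u then - x
           else if \<exists>u\<in>B. per k dvd i - u - 2 ^ k then 1 - x else x) mod p k))"
proof (induction w)
  case Nil
  show ?case by (intro exI[of _ 0] exI[of _ "{}"]) auto
next
  case (Cons l w)
  define n where "n = length w"
  obtain c A B where cAB: "\<bar>c\<bar> \<le> int n" "A \<subseteq> {u. \<bar>u\<bar> \<le> int n}" "B \<subseteq> {u. \<bar>u\<bar> \<le> int n}"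
    and w: "\<And>k i x. 2 * n < 2 ^ k \<Longrightarrow> act w (k, i, x) = rep (k, i + c,
          (if \<exists>u\<in>A. per k dvd i - u then - x
           else if \<exists>u\<in>B. per k dvd i - u - 2 ^ k then 1 - x else x))"
    using Cons.IH unfolding n_def rep.simps by blast
  have cAB': "\<bar>c\<bar> \<le> int (Suc n)" "A \<subseteq> {u. \<bar>u\<bar> \<le> int (Suc n)}" "B \<subseteq> {u. \<bar>u\<bar> \<le> int (Suc n)}"
    using cAB by auto
  have len: "length (l # w) = Suc n" by (simp add: n_def)
  have small: "2 * n < 2 ^ k" if "2 * Suc n < 2 ^ k" for k using that by simp
  show ?case
  proof (cases l)
    case Up
    have "act (l # w) (k, i, x) = rep (k, i + (c + 1),
          (if \<exists>u\<in>A. per k dvd i - u then - x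
           else if \<exists>u\<in>B. per k dvd i - u - 2 ^ k then 1 - x else x))" if "2 * Suc n < 2 ^ k" for k i x
      unfolding Up act_Cons w[OF small[OF that]] step_rep by (simp add: add.assoc)
    moreover have "\<bar>c + 1\<bar> \<le> int (Suc n)" using cAB by simp
    ultimately show ?thesis using cAB'(2,3) unfolding len rep.simps by blast
  next
    case Down
    have "act (l # w) (k, i, x) = rep (k, i + (c - 1),
          (if \<exists>u\<in>A. per k dvd i - u then - x
           else if \<exists>u\<in>B. per k dvd i - u - 2 ^ k then 1 - x else x))" if "2 * Suc n < 2 ^ k" for k i x
      unfolding Down act_Cons w[OF small[OF that]] step_rep by (simp add: algebra_simps)
    moreover have "\<bar>c - 1\<bar> \<le> int (Suc n)" using cAB by simp
    ultimately show ?thesis using cAB'(2,3) unfolding len rep.simps by blast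
  next
    case Flip0
    \<comment> \<open>After \<open>w\<close> the walk stands at \<open>i + c\<close>, so
      \<open>Flip0\<close> changes the parity of the relative position \<open>- c\<close>
      only.\<close>
    define A' where "A' = (if - c \<in> A then A - {- c} else insert (- c) A)"
    have "act (l # w) (k, i, x) = rep (k, i + c,
          (if \<exists>u\<in>A'. per k dvd i - u then - x
           else if \<exists>u\<in>B. per k dvd i - u - 2 ^ k then 1 - x else x))" if k: "2 * Suc n < 2 ^ k" for k i x
    proof (cases "per k dvd i + c")
      case True
      hence True': "per k dvd i - (- c)" by simp
      have uniq: "u = - c" if "u \<in> A" "per k dvd i - u" for u
        using near_unique[OF _ _ small[OF k], of u "-c" i] that cAB True by auto
      \<comment> \<open>No reflection of the other kind has acted here, so \<open>x\<close> has
        become \<open>x\<close> or \<open>- x\<close>, and one more sign change swaps the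
        two.\<close>
      have "\<not> per k dvd i - u - 2 ^ k" if "u \<in> B" for u
        using near_far[OF _ _ small[OF k], of "-c" u i] that cAB True by auto
      moreover have uniq': "u = - c" if "u \<in> A'" "per k dvd i - u" for u
        using that uniq unfolding A'_def by (metis Diff_iff insertE)
      moreover have "(\<exists>u\<in>A. per k dvd i - u) \<longleftrightarrow> - c \<in> A" using uniq True' by blast
      moreover have "(\<exists>u\<in>A'. per k dvd i - u) \<longleftrightarrow> - c \<in> A'"
        using uniq' True' by blast
      moreover have "- c \<in> A' \<longleftrightarrow> - c \<notin> A" by (simp add: A'_def)
      ultimately show ?thesis
        unfolding Flip0 act_Cons w[OF small[OF k]] step_rep using True by simp
    next
      case False
      hence "(\<exists>u\<in>A'. per k dvd i - u) \<longleftrightarrow> (\<exists>u\<in>A. per k dvd i - u)"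
        by (cases "- c \<in> A") (auto simp: A'_def)
      thus ?thesis
        unfolding Flip0 act_Cons w[OF small[OF k]] step_rep using False by simp
    qed
    moreover have "\<bar>c\<bar> \<le> int (Suc n)" by (rule cAB'(1))
    moreover have "A' \<subseteq> {u. \<bar>u\<bar> \<le> int (Suc n)}" using cAB' by (auto simp: A'_def)
    ultimately show ?thesis using cAB'(2,3) unfolding len rep.simps by blast
  next
    case Flip1
    define B' where "B' = (if - c \<in> B then B - {- c} else insert (- c) B)"
    have "act (l # w) (k, i, x) = rep (k, i + c,
          (if \<exists>u\<in>A. per k dvd i - u then - x
           else if \<exists>u\<in>B'. per k dvd i - u - 2 ^ k then 1 - x else x))" if k: "2 * Suc n < 2 ^ k" for k i x
    proof (cases "per k dvd i + c - 2 ^ k")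
      case True
      hence True': "per k dvd i - (- c) - 2 ^ k" by simp
      have uniq: "u = - c" if "u \<in> B" "per k dvd i - u - 2 ^ k" for u
        using near_unique[OF _ _ small[OF k], of u "-c" "i - 2 ^ k"] that cAB True
        by (auto simp: algebra_simps)
      have "\<not> per k dvd i - u" if "u \<in> A" for u
        using near_far[OF _ _ small[OF k], of u "-c" i] that cAB True' by auto
      moreover have uniq': "u = - c" if "u \<in> B'" "per k dvd i - u - 2 ^ k" for u
        using that uniq unfolding B'_def by (metis Diff_iff insertE)
      moreover have "(\<exists>u\<in>B. per k dvd i - u - 2 ^ k) \<longleftrightarrow> - c \<in> B" using uniq True' by blast
      moreover have "(\<exists>u\<in>B'. per k dvd i - u - 2 ^ k) \<longleftrightarrow> - c \<in> B'"
        using uniq' True' by blast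
      moreover have "- c \<in> B' \<longleftrightarrow> - c \<notin> B" by (simp add: B'_def)
      ultimately show ?thesis
        unfolding Flip1 act_Cons w[OF small[OF k]] step_rep using True by simp
    next
      case False
      hence "(\<exists>u\<in>B'. per k dvd i - u - 2 ^ k) \<longleftrightarrow> (\<exists>u\<in>B. per k dvd i - u - 2 ^ k)"
        by (cases "- c \<in> B") (auto simp: B'_def algebra_simps)
      thus ?thesis
        unfolding Flip1 act_Cons w[OF small[OF k]] step_rep using False by simp
    qed
    moreover have "\<bar>c\<bar> \<le> int (Suc n)" by (rule cAB'(1))
    moreover have "B' \<subseteq> {u. \<bar>u\<bar> \<le> int (Suc n)}" using cAB' by (auto simp: B'_def)
    ultimately show ?thesis using cAB'(2,3) unfolding len rep.simps by blast
  qed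
qed

text \<open>Coordinate \<open>K\<close> is already far enough out for \<open>act_structure\<close>.
  Triviality there forces \<open>c = 0\<close> and empty \<open>A\<close> and \<open>B\<close>, and
  these data are the same in all later coordinates.\<close>

lemma act_eq_rep:
  assumes "2 * length w < 2 ^ K" "\<And>k i x. k \<le> K \<Longrightarrow> act w (k, i, x) = rep (k, i, x)"
  shows "act w = rep"
proof -
  define n where "n = length w"
  obtain c A B where cAB: "\<bar>c\<bar> \<le> int n" "A \<subseteq> {u. \<bar>u\<bar> \<le> int n}" "B \<subseteq> {u. \<bar>u\<bar> \<le> int n}"
    and w: "\<And>k i x. 2 * n < 2 ^ k \<Longrightarrow> act w (k, i, x) = (k, (i + c) mod per k,
          (if \<exists>u\<in>A. per k dvd i - u then - x
           else if \<exists>u\<in>B. per k dvd i - u - 2 ^ k then 1 - x else x) mod p k)"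
    using act_structure[of w] unfolding n_def by blast
  have K: "2 * n < 2 ^ K" using assms(1) by (simp add: n_def)
  have eq: "(i + c) mod per K = i mod per K"
    "(if \<exists>u\<in>A. per K dvd i - u then - x
           else if \<exists>u\<in>B. per K dvd i - u - 2 ^ K then 1 - x else x) mod p K = x mod p K" for i x :: int
    using assms(2)[of K i x] w[OF K, of i x] by auto
  have "per K dvd 0 - (- c)" using eq(1)[of 0] by (simp add: dvd_eq_mod_eq_0)
  hence c: "c = 0" using near_unique[OF _ _ K, of 0 "-c" 0] cAB by auto
  have p: "int (p K) > 2" using p_gt_2[of K] by simp
  have "u \<notin> A" for u
  proof
    assume "u \<in> A"
    hence "\<exists>v\<in>A. per K dvd u - v" by (intro bexI[of _ u]) auto
    \<comment> \<open>The test value is 1, since \<open>x = 0\<close> is fixed by the reflection;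
      \<open>p K > 2\<close> then gives the contradiction.\<close>
    hence "- 1 mod int (p K) = 1 mod int (p K)" using eq(2)[of u 1] by simp
    hence "int (p K) dvd 2" by (simp add: mod_eq_dvd_iff)
    thus False using p by (auto dest: zdvd_imp_le)
  qed
  moreover have "u \<notin> B" for u
  proof
    assume "u \<in> B"
    hence "\<exists>v\<in>B. per K dvd u + 2 ^ K - v - 2 ^ K" by (intro bexI[of _ u]) auto
    moreover have "\<not> (\<exists>v\<in>A. per K dvd u + 2 ^ K - v)" using \<open>\<And>u. u \<notin> A\<close> by blast
    ultimately have "1 mod int (p K) = 0 mod int (p K)"
      using eq(2)[of "u + 2 ^ K" 0] by (simp only: if_True if_False) simp
    thus False using p by simp
  qed
  ultimately have "A = {}" "B = {}" by auto
  show ?thesis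
  proof (rule ext)
    fix z :: "nat \<times> int \<times> int"
    obtain k i x where z: "z = (k, i, x)" by (cases z)
    show "act w z = rep z"
    proof (cases "k \<le> K")
      case True
      thus ?thesis using assms(2) z by simp
    next
      case False
      hence "(2::nat) ^ K \<le> 2 ^ k" by (intro power_increasing) auto
      hence "2 * n < 2 ^ k" using K by linarith
      thus ?thesis unfolding z by (subst w) (simp_all add: c \<open>A = {}\<close> \<open>B = {}\<close>)
    qed
  qed
qed

section \<open>Commutator words\<close>

text \<open>
  \<open>comm_word k\<close> spells the commutator of the involution \<open>Flip0\<close> and a conjugate of the involution
  \<open>Flip1\<close>; the square of their product.
\<close>

definition half_comm :: "nat \<Rightarrow> letter list" where
  "half_comm k = [Flip0] @ replicate (2 ^ k) Down @ [Flip1] @ replicate (2 ^ k) Up"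

definition comm_word :: "nat \<Rightarrow> letter list" where
  "comm_word k = half_comm k @ half_comm k"

lemma length_comm_word: "length (comm_word k) \<le> 2 ^ (k + 3)"
proof -
  \<comment> \<open>The length is exactly \<open>4 + 4 * 2 ^ k\<close>.\<close>
  have "(1::nat) \<le> 2 ^ k" by simp
  thus ?thesis by (simp add: comm_word_def half_comm_def power_add)
qed

lemma act_replicate_Up: "act (replicate n Up) (j, i, x) = rep (j, i + int n, x)"
proof (induction n)
  case (Suc n)
  have "act (replicate (Suc n) Up) (j, i, x) = step Up (rep (j, i + int n, x))"
    using Suc by simp
  also have "\<dots> = rep (j, i + int (Suc n), x)" unfolding step_rep by (simp add: algebra_simps)
  finally show ?case .
qed simp

lemma act_replicate_Down: "act (replicate n Down) (j, i, x) = rep (j, i - int n, x)"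
proof (induction n)
  case (Suc n)
  have "act (replicate (Suc n) Down) (j, i, x) = step Down (rep (j, i - int n, x))"
    using Suc by simp
  also have "\<dots> = rep (j, i - int (Suc n), x)" unfolding step_rep by (simp add: algebra_simps)
  finally show ?case .
qed simp

text \<open>Read from the right: walk up by \<open>2 ^ k\<close>, reflect there with
  \<open>Flip1\<close>, walk back, reflect with \<open>Flip0\<close>.\<close>

lemma act_half_comm:
  "act (half_comm k) (j, i, x) =
     (let y = (if per j dvd i + 2 ^ k - 2 ^ j then 1 - x else x)
      in rep (j, i, if per j dvd i then - y else y))"
proof -
  define y where "y = (if per j dvd i + 2 ^ k - 2 ^ j then 1 - x else x)"
  have "act (half_comm k) (j, i, x)
      = step Flip0 (act (replicate (2 ^ k) Down) (step Flip1 (act (replicate (2 ^ k) Up) (j, i, x))))"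
    by (simp add: half_comm_def)
  also have "step Flip1 (act (replicate (2 ^ k) Up) (j, i, x)) = rep (j, i + 2 ^ k, y)"
    unfolding act_replicate_Up step_rep by (simp add: y_def)
  also have "act (replicate (2 ^ k) Down) (rep (j, i + 2 ^ k, y)) = rep (j, i, y)"
    unfolding act_rep act_replicate_Down by simp
  also have "step Flip0 (rep (j, i, y)) = rep (j, i, if per j dvd i then - y else y)"
    unfolding step_rep by simp
  finally show ?thesis by (simp add: y_def Let_def)
qed

text \<open>For \<open>j \<noteq> k\<close> at most one of the two reflections acts at any
  \<open>i\<close>, and it cancels in the square. For \<open>j = k\<close> both act at the multiples
  of \<open>per k\<close>, where their product sends \<open>x\<close> to
  \<open>x - 1\<close>.\<close>

lemma act_comm_word:
  "act (comm_word k) (j, i, x) = rep (j, i, if j = k \<and> per k dvd i then x - 2 else x)"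
proof -
  have "\<not> (per j dvd i + 2 ^ k - 2 ^ j \<and> per j dvd i)" if "j \<noteq> k"
  proof
    assume "per j dvd i + 2 ^ k - 2 ^ j \<and> per j dvd i"
    hence "per j dvd (i + 2 ^ k - 2 ^ j) - i" by (elim conjE) (rule dvd_diff)
    thus False using that per_dvd_diff_iff by simp
  qed
  moreover have "act (comm_word k) (j, i, x) = act (half_comm k) (act (half_comm k) (j, i, x))"
    by (simp add: comm_word_def)
  ultimately show ?thesis
    unfolding act_half_comm Let_def act_rep
    by (cases "j = k"; cases "per j dvd i") auto
qed

end

section \<open>Growth of the lamp group\<close>

context lamps
begin

declare split_paired_All [simp del] split_paired_Ex [simp del]

text \<open>Stated for any \<open>G\<close> with an isomorphism \<open>\<phi>\<close> onto the lamp
  group, so that it applies to the copy on the natural numbers.\<close>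

definition fixer :: "('a, 'b) monoid_scheme \<Rightarrow> ('a \<Rightarrow> nat \<times> int \<times> int \<Rightarrow> nat \<times> int \<times> int) \<Rightarrow> nat \<Rightarrow> 'a set" where
  "fixer G \<phi> K = {g \<in> carrier G. \<forall>z. fst z \<le> K \<longrightarrow> \<phi> g z = rep z}"

text \<open>
  The redundant generator \<open>comm_word 0\<close> makes the lower bound hold already for balls of radius
  below 8, where no other commutator is available.
\<close>

definition gens :: "('a, 'b) monoid_scheme \<Rightarrow> ('a \<Rightarrow> nat \<times> int \<times> int \<Rightarrow> nat \<times> int \<times> int) \<Rightarrow> 'a set" where
  "gens G \<phi> = {x \<in> carrier G. \<phi> x \<in> act ` {[Flip0], [Flip1], [Up], comm_word 0}}"

context
  fixes G (structure) and \<phi>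
  assumes group_G: "group G" and iso: "\<phi> \<in> iso G lamp_group"
begin

interpretation group G by (rule group_G)

section \<open>Transport along the isomorphism\<close>

lemma group_hom_lamp_group: "group_hom G lamp_group \<phi>"
  using iso group_lamp_group by (simp add: group_hom_def group_hom_axioms_def iso_def is_group)

lemma hom_one': "\<phi> \<one> = rep"
  using group_hom.hom_one[OF group_hom_lamp_group] by (simp add: lamp_group_def)

lemma hom_mult': "x \<in> carrier G \<Longrightarrow> y \<in> carrier G \<Longrightarrow> \<phi> (x \<otimes> y) z = \<phi> x (\<phi> y z)"
  using group_hom.hom_mult[OF group_hom_lamp_group, of x y] by (simp add: lamp_group_def)

lemma hom_act: "x \<in> carrier G \<Longrightarrow> \<exists>w. \<phi> x = act w"
  using group_hom.hom_closed[OF group_hom_lamp_group, of x] by (auto simp: lamp_group_def)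

lemma act_hom: "\<exists>x\<in>carrier G. \<phi> x = act w"
proof -
  have "act w \<in> \<phi> ` carrier G" using iso by (auto simp: iso_def bij_betw_def lamp_group_def)
  thus ?thesis by force
qed

lemma hom_eqD: "x \<in> carrier G \<Longrightarrow> y \<in> carrier G \<Longrightarrow> \<phi> x = \<phi> y \<Longrightarrow> x = y"
  using iso by (auto simp: iso_def bij_betw_def dest: inj_onD)

lemma hom_fixes [simp]:
  assumes "x \<in> carrier G"
  shows "rep (\<phi> x z) = \<phi> x z" "\<phi> x (rep z) = \<phi> x z" "fst (\<phi> x z) = fst z"
  using hom_act[OF assms] by auto

lemma hom_inv_apply: "x \<in> carrier G \<Longrightarrow> \<phi> (inv x) (\<phi> x z) = rep z"
  using hom_mult'[of "inv x" x z] by (simp add: hom_one')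

lemma hom_apply_inv: "x \<in> carrier G \<Longrightarrow> \<phi> x (\<phi> (inv x) z) = rep z"
  using hom_mult'[of x "inv x" z] by (simp add: hom_one')

lemma hom_inv_act:
  assumes "x \<in> carrier G" "\<phi> x = act w"
  shows "\<phi> (inv x) = act (rev (map inv_letter w))"
proof
  fix z
  have "act (rev (map inv_letter w)) z = act (rev (map inv_letter w)) (\<phi> x (\<phi> (inv x) z))"
    using hom_apply_inv[OF assms(1), of z] by simp
  also have "\<dots> = \<phi> (inv x) z" using assms by (simp add: act_inv)
  finally show "\<phi> (inv x) z = act (rev (map inv_letter w)) z" ..
qed

section \<open>Kernels of the action on finitely many coordinates\<close>

lemma normal_fixer: "fixer G \<phi> K \<lhd> G"
proof -
  have "subgroup (fixer G \<phi> K) G"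
  proof (rule subgroupI)
    show "fixer G \<phi> K \<noteq> {}"
      using one_closed by (auto simp: fixer_def hom_one' intro!: exI[of _ \<one>])
  next
    fix a assume a: "a \<in> fixer G \<phi> K"
    hence ac: "a \<in> carrier G" by (simp add: fixer_def)
    have "\<phi> (inv a) z = rep z" if "fst z \<le> K" for z
    proof -
      have "\<phi> (inv a) z = \<phi> (inv a) (rep z)" using ac by simp
      also have "rep z = \<phi> a z" using a that by (simp add: fixer_def)
      also have "\<phi> (inv a) (\<phi> a z) = rep z" using ac by (rule hom_inv_apply)
      finally show ?thesis .
    qed
    thus "inv a \<in> fixer G \<phi> K" using ac by (simp add: fixer_def)
  qed (auto simp: fixer_def hom_mult')
  moreover have "x \<otimes> h \<otimes> inv x \<in> fixer G \<phi> K" if "x \<in> carrier G" "h \<in> fixer G \<phi> K" for x h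
    using that by (auto simp: fixer_def hom_mult' hom_apply_inv)
  ultimately show ?thesis by (simp add: normal_inv_iff)
qed

text \<open>
  The action of an element on coordinate \<open>k\<close> is affine in \<open>x\<close>, hence determined by the images of the
  points \<open>(k, i, 0)\<close> and \<open>(k, i, 1)\<close>, of which there are \<open>2 * per k\<close>.
\<close>

lemma fixer_index:
  assumes "\<And>k. k \<le> K \<Longrightarrow> 2 ^ (k + 1) * p k \<le> M"
  shows "finite_index G (fixer G \<phi> K)" "subgroup_index G (fixer G \<phi> K) \<le> M ^ (2 ^ (K + 3))"
proof -
  define D where "D = (SIGMA k:{..K}. {0..<per k} \<times> {0, 1::int})"
  define R where "R z = {0..<per (fst z)} \<times> {0..<int (p (fst z))}" for z :: "nat \<times> int \<times> int"
  define B where "B = PiE D R"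
  \<comment> \<open>Only the second component is recorded, because the action preserves the
    coordinate.\<close>
  define f where "f g = restrict (\<lambda>z. snd (\<phi> g z)) D" for g
  have p0: "p k > 0" for k using p_gt_2[of k] by simp
  have snd_rep: "snd (rep z) \<in> R z" for z
    using p0 by (cases z) (auto simp: R_def)
  have fin: "finite D" "finite B" by (auto simp: D_def B_def R_def intro!: finite_PiE)
  have "f \<in> carrier G \<rightarrow> B"
  proof
    fix g assume g: "g \<in> carrier G"
    have "snd (\<phi> g z) \<in> R z" for z
      using snd_rep[of "\<phi> g z"] g by (simp add: R_def)
    thus "f g \<in> B" by (auto simp: f_def B_def)
  qed
  moreover have "x \<otimes> inv y \<in> fixer G \<phi> K" if x: "x \<in> carrier G" and y: "y \<in> carrier G" and eq: "f x = f y" for x y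
  proof -
    have eq_D: "\<phi> x z = \<phi> y z" if "z \<in> D" for z
      using fun_cong[OF eq, of z] that x y by (auto simp: f_def prod_eq_iff)
    have "\<phi> x z = \<phi> y z" if "fst z \<le> K" for z
    proof -
      obtain k i e where z: "z = (k, i, e)" by (cases z)
      have D0: "(k, i mod per k, 0) \<in> D" and D1: "(k, i mod per k, 1) \<in> D"
        using that by (auto simp: z D_def)
      obtain v w where vw: "\<phi> x = act v" "\<phi> y = act w" using hom_act x y by metis
      have "act v (k, i mod per k, e) = act w (k, i mod per k, e)"
        by (rule act_eqI) (use eq_D[OF D0] eq_D[OF D1] vw in simp_all)
      hence "act v (rep (k, i mod per k, e)) = act w (rep (k, i mod per k, e))"
        unfolding act_rep .
      hence "act v (rep z) = act w (rep z)" by (simp add: z)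
      thus ?thesis using vw by simp
    qed
    hence "\<phi> x (\<phi> (inv y) z) = rep z" if "fst z \<le> K" for z
      using that y by (simp add: hom_apply_inv)
    thus ?thesis using x y by (simp add: fixer_def hom_mult')
  qed
  ultimately have index: "finite_index G (fixer G \<phi> K)" "subgroup_index G (fixer G \<phi> K) \<le> card B"
    using subgroup_index_le_card[OF group_G normal_imp_subgroup[OF normal_fixer] fin(2)] by blast+
  have "card B = (\<Prod>z\<in>D. card (R z))" unfolding B_def by (rule card_PiE) (rule fin)
  also have "\<dots> \<le> (\<Prod>z\<in>D. M)"
  proof (rule prod_mono, intro conjI)
    fix z assume "z \<in> D"
    hence "fst z \<le> K" by (auto simp: D_def)
    moreover have "card (R z) = 2 ^ (fst z + 1) * p (fst z)"
      by (simp add: R_def card_cartesian_product per_def nat_mult_distrib nat_power_eq)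
    ultimately show "card (R z) \<le> M" using assms by simp
  qed auto
  also have "\<dots> = M ^ card D" by simp
  also have "card D = (\<Sum>k\<le>K. 2 ^ (k + 2))"
    unfolding D_def by (subst card_SigmaI)
      (auto simp: card_cartesian_product per_def nat_mult_distrib nat_power_eq)
  also have "\<dots> = 4 * (\<Sum>k\<le>K. 2 ^ k)" by (simp add: sum_distrib_left)
  also have "(\<Sum>k\<le>K. 2 ^ k) = (2::nat) ^ (K + 1) - 1"
    by (induction K) auto
  finally have "card B \<le> M ^ (4 * (2 ^ (K + 1) - 1))" .
  also have "M \<ge> 1" using assms[of 0] p0[of 0] by simp
  hence "M ^ (4 * (2 ^ (K + 1) - 1)) \<le> M ^ (2 ^ (K + 3))"
    by (intro power_increasing) (auto simp: power_add)
  finally show "finite_index G (fixer G \<phi> K)" "subgroup_index G (fixer G \<phi> K) \<le> M ^ (2 ^ (K + 3))"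
    using index by auto
qed

section \<open>Generators, words and balls\<close>

lemma gens_subset: "gens G \<phi> \<subseteq> carrier G"
  by (auto simp: gens_def)

lemma finite_gens: "finite (gens G \<phi>)"
proof (rule finite_imageD)
  show "finite (\<phi> ` (gens G \<phi>))"
    by (rule finite_subset[of _ "act ` {[Flip0], [Flip1], [Up], comm_word 0}"]) (auto simp: gens_def)
  show "inj_on \<phi> (gens G \<phi>)" by (rule inj_onI) (use hom_eqD gens_subset in blast)
qed

text \<open>The factor 8 bounds the length of the longest generator,
  \<open>comm_word 0\<close>.\<close>

lemma word_ball_act:
  assumes "g \<in> word_ball G (gens G \<phi>) n"
  shows "\<exists>w. length w \<le> 8 * n \<and> \<phi> g = act w"
proof -
  have letter: "\<exists>w. length w \<le> 8 \<and> \<phi> s = act w" if s: "s \<in> gens G \<phi> \<union> m_inv G ` gens G \<phi>" for s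
  proof -
    have *: "\<exists>w. length w \<le> 8 \<and> \<phi> x = act w" if "x \<in> gens G \<phi>" for x
    proof -
      have "\<phi> x \<in> act ` {[Flip0], [Flip1], [Up], comm_word 0}"
        using that unfolding gens_def by (elim CollectE conjE)
      then obtain w where "w \<in> {[Flip0], [Flip1], [Up], comm_word 0}" "\<phi> x = act w"
        by (elim imageE)
      thus ?thesis using length_comm_word[of 0] by (intro exI[of _ w]) auto
    qed
    show ?thesis
    proof (cases "s \<in> gens G \<phi>")
      case False
      then obtain x where x: "x \<in> gens G \<phi>" "s = inv x" using s by auto
      obtain w where "length w \<le> 8" "\<phi> x = act w" using *[OF x(1)] by blast
      thus ?thesis using hom_inv_act[of x w] x gens_subset
        by (intro exI[of _ "rev (map inv_letter w)"]) auto
    qed (rule *)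
  qed
  have "foldr (\<lambda>x y. x \<otimes> y) ws \<one> \<in> carrier G \<and> 
      (\<exists>w. length w \<le> 8 * length ws \<and> \<phi> (foldr (\<lambda>x y. x \<otimes> y) ws \<one>) = act w)"
    if "set ws \<subseteq> gens G \<phi> \<union> m_inv G ` gens G \<phi>" for ws
    using that
  proof (induction ws)
    case Nil
    show ?case by (auto simp: hom_one')
  next
    case (Cons s ws)
    let ?g = "foldr (\<lambda>x y. x \<otimes> y) ws \<one>"
    have g: "?g \<in> carrier G" and s: "s \<in> carrier G" using Cons gens_subset by auto
    obtain w where w: "length w \<le> 8 * length ws" "\<phi> ?g = act w" using Cons by auto
    obtain v where v: "length v \<le> 8" "\<phi> s = act v" using letter[of s] Cons.prems by auto
    have "\<phi> (s \<otimes> ?g) = act (v @ w)"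
      using g s w v by (auto simp: fun_eq_iff hom_mult')
    moreover have "length (v @ w) \<le> 8 * length (s # ws)" using w v by simp
    ultimately show ?case using g s by (intro conjI exI[of _ "v @ w"]) auto
  qed
  moreover obtain ws where ws: "g = foldr (\<lambda>x y. x \<otimes> y) ws \<one>"
    "set ws \<subseteq> gens G \<phi> \<union> m_inv G ` gens G \<phi>" "length ws \<le> n"
    using assms unfolding word_ball_def by blast
  ultimately obtain w where "length w \<le> 8 * length ws" "\<phi> g = act w" by blast
  with ws(3) show ?thesis by (intro exI[of _ w]) auto
qed

text \<open>Every letter is a generator or, for \<open>Down\<close>, the inverse of one, so no
  length is lost in this direction.\<close>

lemma act_word_ball:
  assumes "x \<in> carrier G" "\<phi> x = act w"
  shows "x \<in> word_ball G (gens G \<phi>) (length w)"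
  using assms
proof (induction w arbitrary: x)
  case Nil
  hence "x = \<one>" by (intro hom_eqD) (auto simp: hom_one')
  thus ?case by (simp add: one_in_word_ball)
next
  case (Cons l w)
  obtain y where y: "y \<in> carrier G" "\<phi> y = act w" using act_hom by blast
  obtain s where s: "s \<in> carrier G" "\<phi> s = act [l]" using act_hom by blast
  have "\<phi> x = \<phi> (s \<otimes> y)"
    using Cons.prems y s by (auto simp: fun_eq_iff hom_mult')
  hence x: "x = s \<otimes> y" using Cons.prems y s by (intro hom_eqD) auto
  have sg: "s \<in> gens G \<phi> \<union> m_inv G ` gens G \<phi>"
  proof (cases "l = Down")
    case True
    hence "\<phi> (inv s) = act [Up]" using hom_inv_act[OF s] by simp
    hence "inv s \<in> gens G \<phi>" using s by (simp add: gens_def)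
    moreover have "s = inv (inv s)" using s by simp
    ultimately show ?thesis by blast
  next
    case False
    thus ?thesis using s by (cases l) (auto simp: gens_def)
  qed
  obtain ws where "y = foldr (\<lambda>x y. x \<otimes> y) ws \<one>" "set ws \<subseteq> gens G \<phi> \<union> m_inv G ` gens G \<phi>" "length ws \<le> length w"
    using Cons.IH[OF y] unfolding word_ball_def by blast
  thus ?case using sg unfolding x word_ball_def
    by (intro CollectI exI[of _ "s # ws"]) auto
qed

lemma generate_gens: "generate G (gens G \<phi>) = carrier G"
proof
  show "generate G (gens G \<phi>) \<subseteq> carrier G" by (rule generate_incl) (rule gens_subset)
  have gen: "foldr (\<lambda>x y. x \<otimes> y) ws \<one> \<in> generate G (gens G \<phi>)" if "set ws \<subseteq> gens G \<phi> \<union> m_inv G ` gens G \<phi>" for ws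
    using that by (induction ws) (auto intro: generate.intros)
  show "carrier G \<subseteq> generate G (gens G \<phi>)"
  proof
    fix x assume "x \<in> carrier G"
    moreover from this obtain w where "\<phi> x = act w" using hom_act by blast
    ultimately have "x \<in> word_ball G (gens G \<phi>) (length w)" by (rule act_word_ball)
    thus "x \<in> generate G (gens G \<phi>)" using gen unfolding word_ball_def by blast
  qed
qed

text \<open>Such a \<open>g\<close> is spelled by at most \<open>8 * n\<close> letters, and
  \<open>act_eq_rep\<close> needs twice that to be below \<open>2 ^ K\<close>.\<close>

lemma fixer_word_ball:
  assumes "g \<in> word_ball G (gens G \<phi>) n" "g \<in> fixer G \<phi> K" "16 * n < 2 ^ K"
  shows "g = \<one>"
proof -
  obtain w where w: "length w \<le> 8 * n" "\<phi> g = act w" using word_ball_act[OF assms(1)] by blast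
  have "\<phi> g = rep" unfolding w(2)
    by (rule act_eq_rep[of _ K]) (use assms w in \<open>auto simp: fixer_def\<close>)
  thus ?thesis using assms(2) by (intro hom_eqD) (auto simp: fixer_def hom_one')
qed

lemma ex_fixer_not_mem:
  assumes "g \<in> carrier G" "g \<noteq> \<one>"
  shows "\<exists>K. g \<notin> fixer G \<phi> K"
proof -
  obtain w where "\<phi> g = act w" using hom_act assms by blast
  hence "g \<in> word_ball G (gens G \<phi>) (length w)" using act_word_ball assms by blast
  moreover have "16 * length w < 2 ^ (16 * length w)" by (rule less_exp)
  ultimately show ?thesis using fixer_word_ball assms by blast
qed

lemma finite_index_fixer: "finite_index G (fixer G \<phi> K)"
  by (rule fixer_index(1)[of _ "\<Sum>k\<le>K. 2 ^ (k + 1) * p k"]) (rule member_le_sum, auto)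

text \<open>At lamp 0 of coordinate \<open>k\<close> the element translates by \<open>- 2\<close>,
  which has order \<open>p k\<close> modulo the odd prime \<open>p k\<close>; elsewhere it is
  trivial. So \<open>prime_le_normal_depth\<close> applies.\<close>

lemma prime_le_normal_depth_comm_word:
  assumes "g \<in> carrier G" "\<phi> g = act (comm_word k)"
  shows "g \<noteq> \<one>" "p k \<le> normal_depth G g"
proof -
  have p: "p k > 2" by (rule p_gt_2)
  have "(- 2) mod int (p k) \<noteq> 0"
  proof
    assume "(- 2) mod int (p k) = 0"
    hence "int (p k) dvd - 2" by (rule mod_0_imp_dvd)
    hence "int (p k) dvd 2" by simp
    hence "int (p k) \<le> 2" by (rule zdvd_imp_le) simp
    thus False using p by simp
  qed
  hence "act (comm_word k) (k, 0, 0) \<noteq> rep (k, 0, 0)" unfolding act_comm_word by simp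
  hence "act (comm_word k) \<noteq> rep" by (intro notI) (simp del: rep.simps)
  thus ne: "g \<noteq> \<one>" unfolding assms(2)[symmetric] hom_one'[symmetric] by blast
  have pow: "\<phi> (g [^] n) (j, i, x) = rep (j, i, if j = k \<and> per k dvd i then x - 2 * int n else x)"
    for n j i x
  proof (induction n arbitrary: x)
    case 0
    show ?case by (simp add: hom_one')
  next
    case (Suc n)
    have "\<phi> (g [^] Suc n) (j, i, x) = \<phi> (g [^] n) (rep (j, i, if j = k \<and> per k dvd i then x - 2 else x))"
      using assms by (simp only: nat_pow_Suc hom_mult' nat_pow_closed act_comm_word)
    also have "\<dots> = \<phi> (g [^] n) (j, i, if j = k \<and> per k dvd i then x - 2 else x)"
      by (rule hom_fixes(2)) (simp add: assms)
    also have "\<dots> = rep (j, i, if j = k \<and> per k dvd i then x - 2 * int (Suc n) else x)"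
      using Suc.IH by (auto simp: algebra_simps)
    finally show ?case .
  qed
  have "\<phi> (g [^] p k) (j, i, x) = rep (j, i, x)" for j i x
    unfolding pow using mod_mult_self2[of x "int (p k)" "- 2"] by (auto simp: algebra_simps)
  hence "\<phi> (g [^] p k) = \<phi> \<one>" unfolding hom_one' by auto
  hence "g [^] p k = \<one>" using assms by (intro hom_eqD) auto
  moreover obtain K where "g \<notin> fixer G \<phi> K" using ex_fixer_not_mem[OF assms(1) ne] by blast
  ultimately show "p k \<le> normal_depth G g"
    using prime_le_normal_depth[OF group_G prime_p assms(1) _ normal_fixer finite_index_fixer] by blast
qed

lemma prime_le_rf_growth:
  assumes "2 ^ (k + 3) \<le> n"
  shows "p k \<le> rf_growth G (gens G \<phi>) n"
proof -
  obtain g where g: "g \<in> carrier G" "\<phi> g = act (comm_word k)" using act_hom by blast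
  have "g \<in> word_ball G (gens G \<phi>) n"
    using act_word_ball[OF g] word_ball_mono length_comm_word[of k] assms by (meson le_trans subsetD)
  thus ?thesis
    using normal_depth_le_rf_growth[OF finite_gens] prime_le_normal_depth_comm_word[OF g]
    by (meson le_trans)
qed

lemma prime_0_le_rf_growth:
  assumes "n \<ge> 1"
  shows "p 0 \<le> rf_growth G (gens G \<phi>) n"
proof -
  obtain g where g: "g \<in> carrier G" "\<phi> g = act (comm_word 0)" using act_hom by blast
  hence "g \<in> gens G \<phi>" by (simp add: gens_def)
  hence "g \<in> word_ball G (gens G \<phi>) n"
    using generators_subset_word_ball[OF group_G gens_subset assms] by blast
  thus ?thesis
    using normal_depth_le_rf_growth[OF finite_gens] prime_le_normal_depth_comm_word[OF g]
    by (meson le_trans)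
qed

text \<open>Injectivity at radius \<open>n\<close> is tested on the ball of radius
  \<open>2 * n\<close>, which doubles the constant 16.\<close>

lemma fixer_injectivity_radius:
  assumes "n \<ge> 1" "32 * n < 2 ^ K"
  shows "enat n \<le> injectivity_radius G (gens G \<phi>) (fixer G \<phi> K)"
  by (rule le_injectivity_radiusI[OF group_G gens_subset normal_fixer assms(1)],
      rule fixer_word_ball[of _ "2 * n"]) (use assms in auto)

end

end

section \<open>Choice of the primes and proof of the bounds\<close>

text \<open>Serves the case of constant \<open>F = 1\<close>, which leaves no room for primes; the
  witness is the trivial group with no generators.\<close>

lemma ex_trivial_growth_one:
  "\<exists>(G :: nat monoid) S. group G \<and> finite S \<and> S \<subseteq> carrier G \<and> generate G S = carrier G \<and>
     residually_finite G \<and> (\<forall>n\<ge>1. rf_growth G S n = 1 \<and> full_rf_growth G S n = 1)"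
proof -
  define G :: "nat monoid" where "G = \<lparr>carrier = {0}, monoid.mult = (\<lambda>_ _. 0), one = 0\<rparr>"
  have G: "group G" by (rule groupI) (auto simp: G_def)
  interpret group G by (rule G)
  have carrier: "carrier G = {\<one>\<^bsub>G\<^esub>}" by (simp add: G_def)
  have N: "carrier G \<lhd> G" by (rule normal_inv_iff[THEN iffD2]) (auto intro: subgroup_self)
  have cosets: "rcosets\<^bsub>G\<^esub> (carrier G) = {carrier G}"
    by (auto simp: RCOSETS_def r_coset_def carrier)
  have idx: "finite_index G (carrier G)" "subgroup_index G (carrier G) = 1"
    by (simp_all add: finite_index_def subgroup_index_def cosets)
  have ball: "word_ball G {} n = {\<one>\<^bsub>G\<^esub>}" for n by (auto simp: word_ball_def)
  have "rf_growth G {} n = 1 \<and> full_rf_growth G {} n = 1" if n: "n \<ge> 1" for n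
  proof -
    have rad: "enat n \<le> injectivity_radius G {} (carrier G)"
      unfolding le_injectivity_radius_iff[OF n] by (simp add: ball)
    have "rf_growth G {} n = 1" by (simp add: rf_growth_def ball)
    moreover have "rf_growth G {} n \<le> full_rf_growth G {} n"
      by (rule rf_growth_le_full_rf_growth[OF G _ _ n N idx(1) rad]) auto
    moreover have "full_rf_growth G {} n \<le> 1"
      using full_rf_growth_le[OF N idx(1) rad] idx(2) by simp
    ultimately show ?thesis by simp
  qed
  moreover have "residually_finite G" by (simp add: residually_finite_def carrier)
  moreover have "generate G {} = carrier G" using generate_empty by (simp add: carrier)
  ultimately show ?thesis using G by (intro exI[of _ G] exI[of _ "{}"]) auto
qed

lemma (in lamps) ex_growth_bounds:
  "\<exists>(G :: nat monoid) S. group G \<and> finite S \<and> S \<subseteq> carrier G \<and> generate G S = carrier G \<and>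
     residually_finite G \<and>
     (\<forall>n\<ge>1. p 0 \<le> rf_growth G S n) \<and> (\<forall>n k. 2 ^ (k + 3) \<le> n \<longrightarrow> p k \<le> rf_growth G S n) \<and>
     (\<forall>n\<ge>1. rf_growth G S n \<le> full_rf_growth G S n) \<and>
     (\<forall>n\<ge>1. \<forall>K M. 32 * n < 2 ^ K \<longrightarrow> (\<forall>k\<le>K. 2 ^ (k + 1) * p k \<le> M) \<longrightarrow>
        full_rf_growth G S n \<le> M ^ (2 ^ (K + 3)))"
proof -
  have "countable (carrier lamp_group)" by (simp add: lamp_group_def)
  then obtain G :: "nat monoid" and \<phi> where G: "group G" and \<phi>: "\<phi> \<in> iso G lamp_group"
    using ex_iso_nat_group[OF group_lamp_group] by blast
  let ?S = "gens G \<phi>"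
  note assms = G \<phi>
  have residual: "residually_finite G"
    unfolding residually_finite_def
  proof
    fix g assume "g \<in> carrier G - {\<one>\<^bsub>G\<^esub>}"
    then obtain K where "g \<notin> fixer G \<phi> K" using ex_fixer_not_mem[OF assms] by blast
    thus "\<exists>H. subgroup H G \<and> finite_index G H \<and> g \<notin> H"
      using normal_imp_subgroup[OF normal_fixer[OF assms]] finite_index_fixer[OF assms] by blast
  qed
  have full: "full_rf_growth G ?S n \<le> M ^ (2 ^ (K + 3))"
    if "n \<ge> 1" "32 * n < 2 ^ K" "\<forall>k\<le>K. 2 ^ (k + 1) * p k \<le> M" for n K M
  proof -
    have "full_rf_growth G ?S n \<le> subgroup_index G (fixer G \<phi> K)"
      using normal_fixer[OF assms] finite_index_fixer[OF assms]
        fixer_injectivity_radius[OF assms that(1,2)] by (rule full_rf_growth_le)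
    also have "\<dots> \<le> M ^ (2 ^ (K + 3))" using that(3) by (intro fixer_index(2)[OF assms]) auto
    finally show ?thesis .
  qed
  have rf_full: "rf_growth G ?S n \<le> full_rf_growth G ?S n" if n: "n \<ge> 1" for n
    using normal_fixer[OF assms] finite_index_fixer[OF assms]
      fixer_injectivity_radius[OF assms n less_exp]
    by (rule rf_growth_le_full_rf_growth[OF G finite_gens[OF assms] gens_subset[OF assms] n])
  show ?thesis
    by (rule exI[of _ G], rule exI[of _ ?S])
       (use G finite_gens[OF assms] gens_subset[OF assms] generate_gens[OF assms] residual
         prime_0_le_rf_growth[OF assms] prime_le_rf_growth[OF assms] full rf_full in blast)
qed

theorem theorem1p2:
  fixes F :: "nat \<Rightarrow> nat"
  assumes "\<And>n. n \<ge> 1 \<Longrightarrow> F n \<ge> 1"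
    and "mono_on {1..} F"
    and "\<exists>C::real. C > 1 \<and> (\<forall>n\<ge>1. F n ^ n \<le> at_real F (C * real n))"
  shows "\<exists>(G :: nat monoid) (S :: nat set).
           group G \<and> finite S \<and> S \<subseteq> carrier G \<and> generate G S = carrier G \<and>
           residually_finite G \<and>
           (\<exists>C1 C2 :: real. C1 > 0 \<and> C2 > 0 \<and>
             (\<forall>n\<ge>1. at_real F (C1 * real n) \<le> rf_growth G S n \<and>
                     rf_growth G S n \<le> full_rf_growth G S n \<and>
                     full_rf_growth G S n \<le> at_real F (C2 * real n)))"
proof (cases "\<forall>n\<ge>1. F n = 1")
  case True
  have "at_real F (1 * real n) = 1" if "n \<ge> 1" for n using True that by (simp add: at_real_def)
  moreover obtain G :: "nat monoid" and S where "group G" "finite S" "S \<subseteq> carrier G"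
    "generate G S = carrier G" "residually_finite G"
    "\<forall>n\<ge>1. rf_growth G S n = 1 \<and> full_rf_growth G S n = 1"
    using ex_trivial_growth_one by blast
  ultimately show ?thesis
    by (intro exI[of _ G] exI[of _ S] conjI exI[of _ 1]) auto
next
  case False
  then obtain n0 where n0: "n0 \<ge> 1" "F n0 \<ge> 2"
    using assms(1) by (metis One_nat_def Suc_1 Suc_leI le_neq_implies_less)
  have mono: "F a \<le> F b" if "1 \<le> a" "a \<le> b" for a b
    using assms(2) that by (auto simp: mono_on_def)
  obtain C :: real where C: "C > 1" "\<And>n. n \<ge> 1 \<Longrightarrow> F n ^ n \<le> at_real F (C * real n)"
    using assms(3) by blast
  \<comment> \<open>By monotonicity the real \<open>C\<close> may be rounded up, which removes the
    ceilings.\<close>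
  define D where "D = nat \<lceil>C\<rceil>"
  have D: "D \<ge> 1" "C \<le> real D" using C(1) by (auto simp: D_def) linarith+
  have pow: "F n ^ n \<le> F (D * n)" if n: "n \<ge> 1" for n
  proof -
    have "C * real n > 0" using C(1) n by simp
    moreover have "C * real n \<le> real (D * n)" using D(2) by (simp add: mult_right_mono)
    ultimately have "1 \<le> nat \<lceil>C * real n\<rceil>" "nat \<lceil>C * real n\<rceil> \<le> D * n" by linarith+
    hence "at_real F (C * real n) \<le> F (D * n)" unfolding at_real_def by (rule mono)
    with C(2)[OF n] show ?thesis by simp
  qed
  \<comment> \<open>Chosen so that \<open>n1 * 2 ^ k = D * (n0 * (8 * 2 ^ k))\<close>: one use of
    \<open>pow\<close> then turns \<open>F n0 \<ge> 2\<close> into exponential growth.\<close>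
  define n1 where "n1 = 8 * (D * n0)"
  have n1: "n1 \<ge> 1" using D n0 by (simp add: n1_def)
  have large: "2 ^ (8 * 2 ^ k) \<le> F (n1 * 2 ^ k)" for k
  proof -
    define j :: nat where "j = 8 * 2 ^ k"
    have j: "j \<ge> 1" by (simp add: j_def)
    have "2 ^ j \<le> (2::nat) ^ (n0 * j)" using n0 by (intro power_increasing) auto
    also have "\<dots> \<le> F (n0 * j) ^ (n0 * j)"
      using n0 j mono[of n0 "n0 * j"] by (intro power_mono) auto
    also have "\<dots> \<le> F (D * (n0 * j))" using n0 j by (intro pow) simp
    finally show ?thesis by (simp add: j_def n1_def mult_ac)
  qed
  have "\<exists>q. prime q \<and> F (n1 * 2 ^ k) \<le> q \<and> q \<le> F (n1 * 2 ^ k) ^ 3" for k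
  proof (rule ex_prime_le_cube)
    have "(1::nat) \<le> 2 ^ k" by simp
    hence "3 \<le> 8 * (2::nat) ^ k" by linarith
    hence "(2::nat) ^ 3 \<le> 2 ^ (8 * 2 ^ k)" by (intro power_increasing) auto
    thus "8 \<le> F (n1 * 2 ^ k)" using large[of k] by simp
  qed
  then obtain p where p: "prime (p k)" "F (n1 * 2 ^ k) \<le> p k" "p k \<le> F (n1 * 2 ^ k) ^ 3" for k
    by metis
  have "p k > 2" for k
  proof -
    have "(1::nat) \<le> 2 ^ k" by simp
    hence "2 \<le> 8 * (2::nat) ^ k" by linarith
    hence "(2::nat) ^ 2 \<le> 2 ^ (8 * 2 ^ k)" by (intro power_increasing) auto
    thus ?thesis using large[of k] p(2)[of k] by simp
  qed
  then interpret lamps p using p(1) by unfold_locales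
  obtain G :: "nat monoid" and S where GS: "group G" "finite S" "S \<subseteq> carrier G"
    "generate G S = carrier G" "residually_finite G"
    and lower0: "\<forall>n\<ge>1. p 0 \<le> rf_growth G S n"
    and lower: "\<forall>n k. 2 ^ (k + 3) \<le> n \<longrightarrow> p k \<le> rf_growth G S n"
    and rf_full: "\<forall>n\<ge>1. rf_growth G S n \<le> full_rf_growth G S n"
    and upper: "\<forall>n\<ge>1. \<forall>K M. 32 * n < 2 ^ K \<longrightarrow> (\<forall>k\<le>K. 2 ^ (k + 1) * p k \<le> M) \<longrightarrow>
        full_rf_growth G S n \<le> M ^ (2 ^ (K + 3))"
    using ex_growth_bounds by (elim exE conjE) (rule that)
  have "at_real F (1 / 16 * real n) \<le> rf_growth G S n" if n: "n \<ge> 1" for n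
  proof -
    \<comment> \<open>For \<open>n < 8\<close> the choice \<open>k = 0\<close> works; otherwise
      \<open>k\<close> is given by \<open>2 ^ (k + 3) \<le> n < 2 ^ (k + 4)\<close>. Hence the
      constant 1/16.\<close>
    obtain k where k: "p k \<le> rf_growth G S n" "n \<le> 16 * 2 ^ k"
    proof (cases "n < 8")
      case True
      thus thesis using that[of 0] lower0 n by simp
    next
      case False
      obtain i where i: "2 ^ i \<le> n" "n < 2 ^ Suc i" using ex_power_ivl1[of 2 n] n by auto
      have "i \<ge> 3"
      proof (rule ccontr)
        assume "\<not> i \<ge> 3"
        hence "(2::nat) ^ Suc i \<le> 2 ^ 3" by (intro power_increasing) auto
        with i False show False by simp
      qed
      then obtain k where "i = k + 3" by (metis add.commute le_Suc_ex)
      thus thesis using that[of k] lower[rule_format, of k n] i by (simp add: power_add)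
    qed
    have "real n \<le> real (16 * 2 ^ k)" using k(2) by (simp only: of_nat_le_iff)
    hence "1 / 16 * real n \<le> real (2 ^ k)" by simp
    hence "nat \<lceil>1 / 16 * real n\<rceil> \<le> 2 ^ k" by linarith
    also have "(2::nat) ^ k \<le> n1 * 2 ^ k" using n1 by simp
    finally have "at_real F (1 / 16 * real n) \<le> F (n1 * 2 ^ k)"
      unfolding at_real_def using n by (intro mono) linarith+
    with p(2)[of k] k(1) show ?thesis by simp
  qed
  moreover have "full_rf_growth G S n \<le> at_real F (real (2048 * D * n1) * real n)" if n: "n \<ge> 1" for n
  proof -
    \<comment> \<open>\<open>K = Suc i\<close> is the least exponent with
      \<open>32 * n < 2 ^ K\<close>, so \<open>2 ^ K\<close> is at most \<open>64 * n\<close>;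
      together with the factor 32 in the exponent of \<open>y\<close> below this gives 2048.\<close>
    obtain i where i: "2 ^ i \<le> 32 * n" "32 * n < 2 ^ Suc i"
      using ex_power_ivl1[of 2 "32 * n"] n by auto
    define K where "K = Suc i"
    have K: "32 * n < 2 ^ K" "2 ^ K \<le> 64 * n" using i by (simp_all add: K_def)
    define y where "y = F (n1 * 2 ^ K)"
    \<comment> \<open>The bound \<open>M\<close> is \<open>y ^ 4\<close>: one factor
      \<open>y\<close> for the number of lamps, by \<open>large\<close>, and three for the
      prime.\<close>
    have "2 ^ (k + 1) * p k \<le> y ^ 4" if k: "k \<le> K" for k
    proof -
      have k': "(2::nat) ^ k \<le> 2 ^ K" using k by (intro power_increasing) auto
      have "K < 2 ^ K" by (rule less_exp)
      hence "(2::nat) ^ (k + 1) \<le> 2 ^ (8 * 2 ^ K)"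
        using k by (intro power_increasing) linarith+
      also have "\<dots> \<le> y" unfolding y_def by (rule large)
      finally have "2 ^ (k + 1) \<le> y" .
      moreover have "F (n1 * 2 ^ k) \<le> y" unfolding y_def using n1 k' by (intro mono) auto
      hence "p k \<le> y ^ 3" using p(3)[of k] by (meson le_trans power_mono zero_le)
      ultimately have "2 ^ (k + 1) * p k \<le> y * y ^ 3" by (rule mult_le_mono)
      thus ?thesis by (simp add: power_numeral_reduce)
    qed
    hence "full_rf_growth G S n \<le> (y ^ 4) ^ (2 ^ (K + 3))" using upper n K(1) by blast
    also have "\<dots> = y ^ (32 * 2 ^ K)" by (simp add: power_add flip: power_mult)
    \<comment> \<open>Exponent and argument of \<open>F\<close> are both enlarged to
      \<open>n1 * 2 ^ K * 32\<close>, so that \<open>pow\<close> absorbs the power.\<close>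
    also have "y \<ge> 1" unfolding y_def using n1 by (intro assms(1)) simp
    hence "y ^ (32 * 2 ^ K) \<le> y ^ (n1 * 2 ^ K * 32)"
      using n1 by (intro power_increasing) auto
    also have "\<dots> \<le> F (n1 * 2 ^ K * 32) ^ (n1 * 2 ^ K * 32)"
      unfolding y_def using n1 by (intro power_mono mono) auto
    also have "\<dots> \<le> F (D * (n1 * 2 ^ K * 32))" using n1 by (intro pow) simp
    also have "\<dots> \<le> F (2048 * D * n1 * n)"
    proof (rule mono)
      show "D * (n1 * 2 ^ K * 32) \<le> 2048 * D * n1 * n"
        using mult_le_mono2[OF K(2), of "D * n1 * 32"] by (simp add: mult_ac)
    qed (use D n1 in simp)
    also have "\<dots> = at_real F (real (2048 * D * n1) * real n)"
      unfolding at_real_def of_nat_mult[symmetric] by (simp del: of_nat_mult)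
    finally show ?thesis .
  qed
  moreover have "real (2048 * D * n1) > 0" using D n1 by simp
  ultimately show ?thesis
    using GS rf_full
    by (intro exI[of _ G] exI[of _ S] conjI exI[of _ "1 / 16"] exI[of _ "real (2048 * D * n1)"]) auto
qed

end
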